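(* Suppose there is an algorithm $\mathcal A$ that, given $2^1$-list accurate predictions, solves the $\#s$-$\triangle$ problem with polynomial preprocessing time $P(n)$, update time $U(n)$ and query time $Q(n)$. Then, if the OuMv conjecture is true, $U(n)$ and $Q(n)$ cannot satisfy $n^2U(n)+nQ(n)=\tilde{\tilde o}(n^3)$.
   Context: The $\#s$-$\triangle$ problem: a dynamic undirected graph on $n$ vertices with a fixed vertex $s$ is given initially; each update flips an edge (inserts it if absent, deletes it if present); each query asks for the number of triangles containing $s$ in the current graph. Requests arrive online; queries must be answered before the next request. A sequence of sets $\hat\rho=(\hat\rho_1,\ldots,\hat\rho_T)$ of requests is $L$-list accurate for a set $\mathcal S$ of request sequences if $|\hat\rho_t|\le L$ and $\rho_t\in\hat\rho_t$ for all $\rho\in\mathcal S$ and $t$; an algorithm with $L$-list accurate predictions receives $\hat\rho$ in preprocessing and must be correct on every request sequence for which $\hat\rho$ is $L$-list accurate. OuMv conjecture: for every constant $\varepsilon>0$ there is no algorithm for OuMv (given an $n\times n$ Boolean matrix $M$ for polynomial-time preprocessing, then $n$ online pairs $(\vec u_t,\vec v_t)$, report the Boolean $\vec u_t^\top M\vec v_t$ before the next pair) with total time $O(n^{3-\varepsilon})$ and error probability at most $1/3$ (this follows from the OMv conjecture). $f(n)=\tilde{\tilde o}(n^c)$ means $f(n)\le Cn^{c-\varepsilon}$ for some constants $C,\varepsilon>0$ and all large $n$. *)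

theory Defs
  imports
    "HOL-Probability.Probability"
    "HOL-Library.Landau_Symbols"
    "HOL-Library.More_List"
begin

section \<open>Growth of functions\<close>

definition poly_bounded :: "(nat \<Rightarrow> real) \<Rightarrow> bool" where
  "poly_bounded f \<longleftrightarrow> (\<exists>k::nat. f \<in> O(\<lambda>n. real n ^ k))"

definition poly_smaller :: "(nat \<Rightarrow> real) \<Rightarrow> real \<Rightarrow> bool" where
  "poly_smaller f c \<longleftrightarrow>
     (\<exists>C>0. \<exists>\<epsilon>>0. eventually (\<lambda>n. f n \<le> C * real n powr (c - \<epsilon>)) at_top)"


section \<open>Machine model\<close>

text \<open>
  Algorithms are programs of a randomised unit-cost word RAM. A program uses finitely many
  registers and finitely many zero-initialised arrays of natural numbers. Every evaluated
  operation costs one time step. The parameter \<open>B\<close> of the semantics is the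
  largest number that fits into a machine word: the execution gets stuck as soon as an
  intermediate result exceeds \<open>B\<close>. Below, \<open>B\<close> is always a polynomially bounded function of the
  input size, i.e. words have \<open>O(log)\<close> many bits.
\<close>

datatype binop = Add | Sub | Mul | Div | Mod | Less | Equal | And | Or | Xor

fun binop_sem :: "binop \<Rightarrow> nat \<Rightarrow> nat \<Rightarrow> nat" where
  "binop_sem Add x y = x + y"
| "binop_sem Sub x y = x - y"
| "binop_sem Mul x y = x * y"
| "binop_sem Div x y = x div y"
| "binop_sem Mod x y = x mod y"
| "binop_sem Less x y = of_bool (x < y)"
| "binop_sem Equal x y = of_bool (x = y)"
| "binop_sem And x y = Bit_Operations.and x y"
| "binop_sem Or x y = Bit_Operations.or x y"
| "binop_sem Xor x y = Bit_Operations.xor x y"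

datatype expr =
    Lit nat
  | Reg nat
  | Arr nat expr
  | Bin binop expr expr

datatype com =
    Skip
  | Assign nat expr
  | Store nat expr expr
  | Coin nat
  | Seq com com
  | Cond expr com com
  | Loop expr com

text \<open>\<open>tape_pos\<close> is the number of random bits consumed so far.\<close>

record state =
  regs :: "nat \<Rightarrow> nat"
  arrs :: "nat \<Rightarrow> nat \<Rightarrow> nat"
  tape_pos :: nat

fun eval :: "state \<Rightarrow> expr \<Rightarrow> nat" where
  "eval \<sigma> (Lit k) = k"
| "eval \<sigma> (Reg r) = regs \<sigma> r"
| "eval \<sigma> (Arr a e) = arrs \<sigma> a (eval \<sigma> e)"
| "eval \<sigma> (Bin f e e') = binop_sem f (eval \<sigma> e) (eval \<sigma> e')"

fun fits :: "nat \<Rightarrow> state \<Rightarrow> expr \<Rightarrow> bool" where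
  "fits B \<sigma> (Lit k) \<longleftrightarrow> k \<le> B"
| "fits B \<sigma> (Reg r) \<longleftrightarrow> regs \<sigma> r \<le> B"
| "fits B \<sigma> (Arr a e) \<longleftrightarrow> fits B \<sigma> e \<and> eval \<sigma> (Arr a e) \<le> B"
| "fits B \<sigma> (Bin f e e') \<longleftrightarrow> fits B \<sigma> e \<and> fits B \<sigma> e' \<and> eval \<sigma> (Bin f e e') \<le> B"

fun cost :: "expr \<Rightarrow> nat" where
  "cost (Lit k) = 1"
| "cost (Reg r) = 1"
| "cost (Arr a e) = cost e + 1"
| "cost (Bin f e e') = cost e + cost e' + 1"

text \<open>
  \<open>exec B \<omega> c \<sigma> t \<sigma>'\<close>: started in \<open>\<sigma>\<close> with the infinite tape \<open>\<omega>\<close> of random bits,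
  \<open>c\<close> terminates after \<open>t\<close> time steps in \<open>\<sigma>'\<close>, all numbers being at most \<open>B\<close>.
\<close>

inductive exec ::
  "nat \<Rightarrow> (nat \<Rightarrow> bool) \<Rightarrow> com \<Rightarrow> state \<Rightarrow> nat \<Rightarrow> state \<Rightarrow> bool"
  for B :: nat and \<omega> :: "nat \<Rightarrow> bool" where
  exec_Skip: "exec B \<omega> Skip \<sigma> 1 \<sigma>"
| exec_Assign: "fits B \<sigma> e \<Longrightarrow>
    exec B \<omega> (Assign r e) \<sigma> (cost e + 1) (\<sigma>\<lparr>regs := (regs \<sigma>)(r := eval \<sigma> e)\<rparr>)"
| exec_Store: "fits B \<sigma> i \<Longrightarrow> fits B \<sigma> e \<Longrightarrow>
    exec B \<omega> (Store a i e) \<sigma> (cost i + cost e + 1)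
      (\<sigma>\<lparr>arrs := (arrs \<sigma>)(a := (arrs \<sigma> a)(eval \<sigma> i := eval \<sigma> e))\<rparr>)"
| exec_Coin: "exec B \<omega> (Coin r) \<sigma> 1
    (\<sigma>\<lparr>regs := (regs \<sigma>)(r := of_bool (\<omega> (tape_pos \<sigma>))), tape_pos := tape_pos \<sigma> + 1\<rparr>)"
| exec_Seq: "exec B \<omega> c \<sigma> t \<sigma>' \<Longrightarrow> exec B \<omega> c' \<sigma>' t' \<sigma>'' \<Longrightarrow>
    exec B \<omega> (Seq c c') \<sigma> (t + t') \<sigma>''"
| exec_Cond_True: "fits B \<sigma> e \<Longrightarrow> eval \<sigma> e \<noteq> 0 \<Longrightarrow> exec B \<omega> c \<sigma> t \<sigma>' \<Longrightarrow>
    exec B \<omega> (Cond e c c') \<sigma> (cost e + 1 + t) \<sigma>'"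
| exec_Cond_False: "fits B \<sigma> e \<Longrightarrow> eval \<sigma> e = 0 \<Longrightarrow> exec B \<omega> c' \<sigma> t \<sigma>' \<Longrightarrow>
    exec B \<omega> (Cond e c c') \<sigma> (cost e + 1 + t) \<sigma>'"
| exec_Loop_False: "fits B \<sigma> e \<Longrightarrow> eval \<sigma> e = 0 \<Longrightarrow>
    exec B \<omega> (Loop e c) \<sigma> (cost e + 1) \<sigma>"
| exec_Loop_True: "fits B \<sigma> e \<Longrightarrow> eval \<sigma> e \<noteq> 0 \<Longrightarrow> exec B \<omega> c \<sigma> t \<sigma>' \<Longrightarrow>
    exec B \<omega> (Loop e c) \<sigma>' t' \<sigma>'' \<Longrightarrow>
    exec B \<omega> (Loop e c) \<sigma> (cost e + 1 + t + t') \<sigma>''"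

definition coin_space :: "(nat \<Rightarrow> bool) measure" where
  "coin_space = PiM UNIV (\<lambda>_. measure_pmf (bernoulli_pmf (1/2)))"


section \<open>Online algorithms\<close>

text \<open>
  The preprocessing program runs once, on a memory that contains the input. Then, for each
  request in turn, the environment writes the encoded request to the initial cells of array 0
  and the program \<open>respond\<close> runs on the current memory; its answer is the final content of
  register 0. The next request becomes visible only after \<open>respond\<close> has terminated.
\<close>

record online_alg =
  preprocess :: com
  respond :: com

definition init_state :: "nat list \<Rightarrow> nat list list \<Rightarrow> state" where
  "init_state rs as =
     \<lparr>regs = nth_default 0 rs, arrs = (\<lambda>a. nth_default 0 (nth_default [] as a)), tape_pos = 0\<rparr>"

definition put_request :: "nat list \<Rightarrow> state \<Rightarrow> state" where
  "put_request ws \<sigma> =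
     \<sigma>\<lparr>arrs := (arrs \<sigma>)(0 := (\<lambda>i. if i < length ws then ws ! i else arrs \<sigma> 0 i))\<rparr>"

text \<open>The last argument lists the time spent on and the answer given to each request.\<close>

inductive serve ::
  "nat \<Rightarrow> (nat \<Rightarrow> bool) \<Rightarrow> com \<Rightarrow> state \<Rightarrow> nat list list \<Rightarrow> (nat \<times> nat) list \<Rightarrow> bool"
  for B :: nat and \<omega> :: "nat \<Rightarrow> bool" and c :: com where
  serve_Nil: "serve B \<omega> c \<sigma> [] []"
| serve_Cons: "exec B \<omega> c (put_request ws \<sigma>) t \<sigma>' \<Longrightarrow> serve B \<omega> c \<sigma>' wss out \<Longrightarrow>
    serve B \<omega> c \<sigma> (ws # wss) ((t, regs \<sigma>' 0) # out)"

definition online_run ::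
  "nat \<Rightarrow> (nat \<Rightarrow> bool) \<Rightarrow> online_alg \<Rightarrow> state \<Rightarrow> nat list list \<Rightarrow> nat \<Rightarrow> (nat \<times> nat) list \<Rightarrow> bool"
where
  "online_run B \<omega> alg \<sigma> wss t0 out \<longleftrightarrow>
     (\<exists>\<sigma>'. exec B \<omega> (preprocess alg) \<sigma> t0 \<sigma>' \<and> serve B \<omega> (respond alg) \<sigma>' wss out)"


section \<open>Counting triangles through \<open>s\<close> with list accurate predictions\<close>

definition all_edges :: "nat \<Rightarrow> nat set set" where
  "all_edges n = {{u, v} | u v. u < n \<and> v < n \<and> u \<noteq> v}"

datatype request = Flip "nat set" | Query

definition requests :: "nat \<Rightarrow> request set" where
  "requests n = insert Query (Flip ` all_edges n)"

fun apply_request :: "request \<Rightarrow> nat set set \<Rightarrow> nat set set" where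
  "apply_request (Flip e) G = (if e \<in> G then G - {e} else insert e G)"
| "apply_request Query G = G"

definition triangles_at :: "nat \<Rightarrow> nat set set \<Rightarrow> nat set set" where
  "triangles_at s G =
     {X. card X = 3 \<and> s \<in> X \<and> (\<forall>u\<in>X. \<forall>v\<in>X. u \<noteq> v \<longrightarrow> {u, v} \<in> G)}"

definition list_accurate ::
  "nat \<Rightarrow> request set list \<Rightarrow> request list set \<Rightarrow> bool" where
  "list_accurate L rhat S \<longleftrightarrow>
     (\<forall>R\<in>set rhat. finite R \<and> card R \<le> L) \<and>
     (\<forall>\<rho>\<in>S. length \<rho> = length rhat \<and> (\<forall>t<length rhat. \<rho> ! t \<in> rhat ! t))"

fun encode_request :: "request \<Rightarrow> nat list" where
  "encode_request Query = [0, 0, 0]"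
| "encode_request (Flip e) = [1, Min e, Max e]"

definition encode_graph :: "nat \<Rightarrow> nat set set \<Rightarrow> nat list" where
  "encode_graph n G = concat (map (\<lambda>u. map (\<lambda>v. of_bool ({u, v} \<in> G)) [0..<n]) [0..<n])"

definition encode_predictions :: "request list list \<Rightarrow> nat list" where
  "encode_predictions ps = concat (map (\<lambda>p. length p # concat (map encode_request p)) ps)"

text \<open>Registers 0, 1, 2 hold \<open>n\<close>, \<open>s\<close> and the number \<open>T\<close> of predicted sets.\<close>

definition striangle_input ::
  "nat \<Rightarrow> nat \<Rightarrow> nat set set \<Rightarrow> request list list \<Rightarrow> state" where
  "striangle_input n s G ps =
     init_state [n, s, length ps] [[], encode_graph n G, encode_predictions ps]"

definition striangle_correct ::
  "nat \<Rightarrow> nat set set \<Rightarrow> request list \<Rightarrow> (nat \<times> nat) list \<Rightarrow> bool" where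
  "striangle_correct s G \<rho> out \<longleftrightarrow>
     (\<forall>t<length \<rho>. \<rho> ! t = Query \<longrightarrow>
        snd (out ! t) = card (triangles_at s (fold apply_request (take t \<rho>) G)))"

text \<open>
  The predicted sets are given to the algorithm as duplicate-free lists in arbitrary order.
  The preprocessing input has size polynomial in \<open>n + T\<close>, so this is the argument of \<open>P\<close> and
  of the word bound \<open>W\<close>; the bounds \<open>U\<close> and \<open>Q\<close> on the time for each single update and query
  depend on \<open>n\<close> only. The time bounds hold for every outcome of the coin flips; the answers are all
  correct with probability at least \<open>1 - \<delta>\<close>. For \<open>\<delta> = 0\<close> there is no error.
\<close>

definition solves_striangle_predicted ::
  "nat \<Rightarrow> real \<Rightarrow> online_alg \<Rightarrow> (nat \<Rightarrow> real) \<Rightarrow> (nat \<Rightarrow> real) \<Rightarrow> (nat \<Rightarrow> real) \<Rightarrow> bool"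
where
  "solves_striangle_predicted L \<delta> alg P U Q \<longleftrightarrow>
     (\<exists>W :: nat \<Rightarrow> nat. poly_bounded (\<lambda>m. real (W m)) \<and>
       (\<forall>n s G ps \<rho>.
          s < n \<and> G \<subseteq> all_edges n \<and>
          (\<forall>p\<in>set ps. distinct p \<and> set p \<subseteq> requests n) \<and>
          list_accurate L (map set ps) {\<rho>} \<longrightarrow>
          (\<forall>\<omega>. \<exists>t0 out.
             online_run (W (n + length ps)) \<omega> alg (striangle_input n s G ps)
               (map encode_request \<rho>) t0 out \<and>
             real t0 \<le> P (n + length ps) \<and>
             (\<forall>t<length \<rho>. real (fst (out ! t)) \<le> (if \<rho> ! t = Query then Q n else U n))) \<and>
          measure coin_space {\<omega>. \<exists>t0 out.
             online_run (W (n + length ps)) \<omega> alg (striangle_input n s G ps)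
               (map encode_request \<rho>) t0 out \<and>
             striangle_correct s G \<rho> out} \<ge> 1 - \<delta>))"


section \<open>The OuMv conjecture\<close>

text \<open>Boolean matrices and vectors are functions of which only the values at indices
  below \<open>n\<close> matter.\<close>

definition bool_uMv ::
  "nat \<Rightarrow> (nat \<Rightarrow> nat \<Rightarrow> bool) \<Rightarrow> (nat \<Rightarrow> bool) \<Rightarrow> (nat \<Rightarrow> bool) \<Rightarrow> bool" where
  "bool_uMv n M u v \<longleftrightarrow> (\<exists>i<n. \<exists>j<n. u i \<and> M i j \<and> v j)"

definition encode_vec :: "nat \<Rightarrow> (nat \<Rightarrow> bool) \<Rightarrow> nat list" where
  "encode_vec n u = map (\<lambda>i. of_bool (u i)) [0..<n]"

definition oumv_input :: "nat \<Rightarrow> (nat \<Rightarrow> nat \<Rightarrow> bool) \<Rightarrow> state" where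
  "oumv_input n M = init_state [n] [[], concat (map (\<lambda>i. encode_vec n (M i)) [0..<n])]"

definition encode_pair :: "nat \<Rightarrow> (nat \<Rightarrow> bool) \<times> (nat \<Rightarrow> bool) \<Rightarrow> nat list" where
  "encode_pair n uv = encode_vec n (fst uv) @ encode_vec n (snd uv)"

definition oumv_correct ::
  "nat \<Rightarrow> (nat \<Rightarrow> nat \<Rightarrow> bool) \<Rightarrow> ((nat \<Rightarrow> bool) \<times> (nat \<Rightarrow> bool)) list \<Rightarrow>
   (nat \<times> nat) list \<Rightarrow> bool" where
  "oumv_correct n M uvs out \<longleftrightarrow>
     (\<forall>t<length uvs. snd (out ! t) = of_bool (bool_uMv n M (fst (uvs ! t)) (snd (uvs ! t))))"

text \<open>\<open>P\<close> bounds the preprocessing time, \<open>\<tau>\<close> the total time for the \<open>n\<close> online pairs.\<close>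

definition solves_oumv ::
  "real \<Rightarrow> online_alg \<Rightarrow> (nat \<Rightarrow> real) \<Rightarrow> (nat \<Rightarrow> real) \<Rightarrow> bool" where
  "solves_oumv \<delta> alg P \<tau> \<longleftrightarrow>
     (\<exists>W :: nat \<Rightarrow> nat. poly_bounded (\<lambda>m. real (W m)) \<and>
       (\<forall>n M uvs. length uvs = n \<longrightarrow>
          (\<forall>\<omega>. \<exists>t0 out.
             online_run (W n) \<omega> alg (oumv_input n M) (map (encode_pair n) uvs) t0 out \<and>
             real t0 \<le> P n \<and>
             real (sum_list (map fst out)) \<le> \<tau> n) \<and>
          measure coin_space {\<omega>. \<exists>t0 out.
             online_run (W n) \<omega> alg (oumv_input n M) (map (encode_pair n) uvs) t0 out \<and>
             oumv_correct n M uvs out} \<ge> 1 - \<delta>))"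

definition OuMv_conjecture :: bool where
  "OuMv_conjecture \<longleftrightarrow>
     (\<forall>\<epsilon>>0. \<not> (\<exists>alg P \<tau>. poly_bounded P \<and> \<tau> \<in> O(\<lambda>n. real n powr (3 - \<epsilon>)) \<and>
                 solves_oumv (1/3) alg P \<tau>))"

end

theory Submission
  imports Defs
begin

text \<open>
  Encode an OuMv instance as a graph with a vertex \<open>s\<close>, a vertex per row and per column of \<open>M\<close>,
  and a dummy vertex: \<open>M\<close> is the bipartite adjacency matrix between rows and columns, and \<open>s\<close> is
  adjacent to the support of the current pair \<open>(u, v)\<close>. Then \<open>u\<^sup>T M v\<close> is true iff some triangle
  contains \<open>s\<close>. To move to the next pair, go through all \<open>2n\<close> edges at \<open>s\<close> in a fixed order and flip
  either this edge or, if nothing changes, the irrelevant edge from \<open>s\<close> to the dummy vertex. So every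
  update is one of two requests that are known in advance, and \<open>n\<close> rounds cost \<open>2n\<^sup>2\<close> updates
  and \<open>n\<close> queries on \<open>2n + 2\<close> vertices.

  The reduction is carried out on the word RAM: a program for OuMv runs the given algorithm on
  renamed registers and arrays. Its success event is measurable since every run reads only
  finitely many coin flips, so that it is a countable union of cylinders.
\<close>

section \<open>Runs of programs\<close>

text \<open>Predictions are positional: the t-th request has to lie in the t-th set. If an unchanged
  coordinate sent no request, all later positions would shift by an amount that depends on the
  vectors. The dummy edge acts as a no-op that keeps every position fixed, so each set needs at most
  two members.

  A round costs \<open>2 * n\<close> updates, one query and \<open>O(n)\<close> work of the host.
  The total is \<open>2 * n ^ 2 * U + n * Q + O(n ^ 2)\<close>, with \<open>U\<close> and
  \<open>Q\<close> taken at \<open>2 * n + 2\<close> vertices, which is the quantity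
  \<open>n ^ 2 * U n + n * Q n\<close> up to constants and a harmless quadratic term.

  The host tosses no coins, so both programs read the same tape and the error probability carries
  over. A run of the guest on the requests is taken as given, and a run of the host is built around
  it; since the specifications ask for the existence of a run, \<open>wp\<close> is existential.
  Execution gets stuck on overflow, hence every host expression must be shown to fit, and the word
  bound of the host is that of the guest plus a quadratic term for its own indices.\<close>

definition wp ::
  "nat \<Rightarrow> (nat \<Rightarrow> bool) \<Rightarrow> com \<Rightarrow> (nat \<Rightarrow> state \<Rightarrow> bool) \<Rightarrow> state \<Rightarrow> bool" where
  "wp B \<omega> c R \<sigma> \<longleftrightarrow> (\<exists>t \<sigma>'. exec B \<omega> c \<sigma> t \<sigma>' \<and> R t \<sigma>')"

inductive_cases exec_SkipE: "exec B \<omega> Skip \<sigma> t \<sigma>'"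
inductive_cases exec_AssignE: "exec B \<omega> (Assign r e) \<sigma> t \<sigma>'"
inductive_cases exec_StoreE: "exec B \<omega> (Store a i e) \<sigma> t \<sigma>'"
inductive_cases exec_SeqE: "exec B \<omega> (Seq c c') \<sigma> t \<sigma>'"
inductive_cases exec_CondE: "exec B \<omega> (Cond e c c') \<sigma> t \<sigma>'"

lemma wp_Skip: "wp B \<omega> Skip R \<sigma> \<longleftrightarrow> R 1 \<sigma>"
  unfolding wp_def by (rule iffI, fastforce elim!: exec_SkipE, blast intro: exec_Skip)

lemma wp_Assign:
  "wp B \<omega> (Assign r e) R \<sigma> \<longleftrightarrow>
     fits B \<sigma> e \<and> R (cost e + 1) (\<sigma>\<lparr>regs := (regs \<sigma>)(r := eval \<sigma> e)\<rparr>)"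
  unfolding wp_def by (rule iffI, fastforce elim!: exec_AssignE, blast intro: exec_Assign)

lemma wp_Store:
  "wp B \<omega> (Store a i e) R \<sigma> \<longleftrightarrow>
     fits B \<sigma> i \<and> fits B \<sigma> e \<and>
     R (cost i + cost e + 1)
       (\<sigma>\<lparr>arrs := (arrs \<sigma>)(a := (arrs \<sigma> a)(eval \<sigma> i := eval \<sigma> e))\<rparr>)"
  unfolding wp_def by (rule iffI, fastforce elim!: exec_StoreE, blast intro: exec_Store)

lemma wp_Seq:
  "wp B \<omega> (Seq c c') R \<sigma> \<longleftrightarrow> wp B \<omega> c (\<lambda>t. wp B \<omega> c' (\<lambda>t'. R (t + t'))) \<sigma>"
  unfolding wp_def by (rule iffI, blast elim!: exec_SeqE, blast intro: exec_Seq)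

lemma wp_Cond:
  "wp B \<omega> (Cond e c c') R \<sigma> \<longleftrightarrow>
     fits B \<sigma> e \<and> (if eval \<sigma> e \<noteq> 0 then wp B \<omega> c (\<lambda>t. R (cost e + 1 + t)) \<sigma>
                  else wp B \<omega> c' (\<lambda>t. R (cost e + 1 + t)) \<sigma>)"
  (is "?L \<longleftrightarrow> ?R")
proof
  assume ?L
  then show ?R unfolding wp_def by (elim exE conjE exec_CondE) auto
next
  assume ?R
  then show ?L unfolding wp_def
    by (auto simp del: One_nat_def split: if_splits intro: exec_Cond_True exec_Cond_False)
qed

lemmas wp_simps = wp_Skip wp_Assign wp_Store wp_Seq wp_Cond

lemma wp_mono:
  "wp B \<omega> c R \<sigma> \<Longrightarrow> (\<And>t \<sigma>'. R t \<sigma>' \<Longrightarrow> R' t \<sigma>') \<Longrightarrow> wp B \<omega> c R' \<sigma>"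
  unfolding wp_def by blast

text \<open>Each pass pays 3 for evaluating the guard and 1 for the branch, and so does the failing
  last test; this explains both occurrences of 4. The bounds on \<open>B\<close> make the guard fit.
  The induction runs downwards from \<open>m\<close>, because the time still to be spent is a sum
  over the remaining indices.\<close>

lemma wp_for_loop:
  assumes body: "\<And>j \<sigma>. j < m \<Longrightarrow> I j \<sigma> \<Longrightarrow> wp B \<omega> c (\<lambda>t \<sigma>'. t \<le> f j \<and> I (Suc j) \<sigma>') \<sigma>"
    and counter: "\<And>j \<sigma>. j \<le> m \<Longrightarrow> I j \<sigma> \<Longrightarrow> regs \<sigma> i = j \<and> regs \<sigma> l = m"
    and "m \<le> B" "1 \<le> B" and start: "I 0 \<sigma>"
  shows "wp B \<omega> (Loop (Bin Less (Reg i) (Reg l)) c)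
           (\<lambda>t \<sigma>'. t \<le> (\<Sum>j<m. f j + 4) + 4 \<and> I m \<sigma>') \<sigma>"
proof -
  let ?g = "Bin Less (Reg i) (Reg l)"
  have "\<exists>t \<sigma>'. exec B \<omega> (Loop ?g c) \<sigma> t \<sigma>' \<and> t \<le> (\<Sum>j=j..<m. f j + 4) + 4 \<and> I m \<sigma>'"
    if "j \<le> m" "I j \<sigma>" for j \<sigma>
    using that
  proof (induction j arbitrary: \<sigma> rule: inc_induct)
    case base
    have "exec B \<omega> (Loop ?g c) \<sigma> (cost ?g + 1) \<sigma>"
      using counter[OF order_refl base] assms(3,4) by (intro exec_Loop_False) auto
    then show ?case using base by (intro exI[of _ "cost ?g + 1"] exI[of _ \<sigma>]) auto
  next
    case (step j)
    obtain t \<sigma>' where 1: "exec B \<omega> c \<sigma> t \<sigma>'" "t \<le> f j" "I (Suc j) \<sigma>'"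
      using body[OF step.hyps(2) step.prems] unfolding wp_def by blast
    obtain t' \<sigma>'' where 2: "exec B \<omega> (Loop ?g c) \<sigma>' t' \<sigma>''"
      "t' \<le> (\<Sum>j=Suc j..<m. f j + 4) + 4" "I m \<sigma>''"
      using step.IH[OF 1(3)] by blast
    have "exec B \<omega> (Loop ?g c) \<sigma> (cost ?g + 1 + t + t') \<sigma>''"
      using counter[OF _ step.prems] step.hyps assms(3,4)
      by (intro exec_Loop_True[OF _ _ 1(1) 2(1)]) auto
    moreover have "cost ?g + 1 + t + t' \<le> (\<Sum>j=j..<m. f j + 4) + 4"
      using 1 2 step.hyps by (simp add: sum.atLeast_Suc_lessThan)
    ultimately show ?case using 2(3) by blast
  qed
  from this[OF _ start] show ?thesis
    unfolding wp_def by (simp add: atLeast0LessThan)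
qed

text \<open>\<open>Assign\<close> stores only values that passed \<open>fits\<close>, and a coin
  stores 0 or 1, so a register can exceed \<open>B'\<close> only if it did so at the start. The host
  needs this when it reads the guest's answer, since reading a register is itself subject to the
  word bound.\<close>

lemma exec_regs_le:
  "exec B \<omega> c \<sigma> t \<sigma>' \<Longrightarrow> B \<le> B' \<Longrightarrow> 1 \<le> B' \<Longrightarrow> \<forall>r. regs \<sigma> r \<le> B' \<Longrightarrow> \<forall>r. regs \<sigma>' r \<le> B'"
proof (induction rule: exec.induct)
  case (exec_Assign \<sigma> e r)
  have "fits B \<sigma> e \<Longrightarrow> eval \<sigma> e \<le> B" by (cases e) auto
  then show ?case using exec_Assign by auto
qed auto

text \<open>Inversion by position instead of by list constructor: the invariants of the host carry
  the unconsumed part of a given guest run as suffixes \<open>drop p\<close>.\<close>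

lemma serve_drop:
  assumes "serve B \<omega> c \<sigma> (drop p wss) (drop p out)" and "p < length wss"
  obtains \<sigma>' where "exec B \<omega> c (put_request (wss ! p) \<sigma>) (fst (out ! p)) \<sigma>'"
    and "snd (out ! p) = regs \<sigma>' 0"
    and "serve B \<omega> c \<sigma>' (drop (Suc p) wss) (drop (Suc p) out)"
proof -
  have wss: "drop p wss = wss ! p # drop (Suc p) wss" using assms(2) by (simp add: Cons_nth_drop_Suc)
  from assms(1)[unfolded wss] obtain t \<sigma>' out' where
    1: "drop p out = (t, regs \<sigma>' 0) # out'" "exec B \<omega> c (put_request (wss ! p) \<sigma>) t \<sigma>'"
    "serve B \<omega> c \<sigma>' (drop (Suc p) wss) out'"
    by (auto elim: serve.cases)
  have "p < length out" using 1(1) by (metis drop_eq_Nil list.distinct(1) not_le)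
  then have "out ! p = (t, regs \<sigma>' 0)" "drop (Suc p) out = out'"
    using 1(1) by (simp_all add: Cons_nth_drop_Suc[symmetric])
  then show ?thesis using 1 that by auto
qed

text \<open>The counterpart of \<open>serve_drop\<close> on the side of the host, where a run has to
  be built. Invariant and bounds are indexed by the round, and the induction passes them to the tail
  shifted by one.\<close>

lemma serve_rounds:
  assumes "\<And>t \<sigma>. t < length wss \<Longrightarrow> I t \<sigma> \<Longrightarrow>
      wp B \<omega> c (\<lambda>k \<sigma>'. k \<le> f t \<and> regs \<sigma>' 0 = g t \<and> I (Suc t) \<sigma>') (put_request (wss ! t) \<sigma>)"
    and "I 0 \<sigma>"
  shows "\<exists>out. serve B \<omega> c \<sigma> wss out \<and> length out = length wss \<and>
           (\<forall>t<length wss. fst (out ! t) \<le> f t \<and> snd (out ! t) = g t)"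
  using assms
proof (induction wss arbitrary: I f g \<sigma>)
  case Nil
  show ?case by (auto intro: serve_Nil)
next
  case (Cons ws wss)
  obtain k \<sigma>' where 1: "exec B \<omega> c (put_request ws \<sigma>) k \<sigma>'" "k \<le> f 0" "regs \<sigma>' 0 = g 0" "I (Suc 0) \<sigma>'"
    using Cons.prems(1)[of 0, OF _ Cons.prems(2)] unfolding wp_def by auto
  have "\<exists>out. serve B \<omega> c \<sigma>' wss out \<and> length out = length wss \<and>
          (\<forall>t<length wss. fst (out ! t) \<le> f (Suc t) \<and> snd (out ! t) = g (Suc t))"
    by (rule Cons.IH[where I = "\<lambda>t. I (Suc t)"]) (use Cons.prems(1)[of "Suc _"] 1 in auto)
  then obtain out where 2: "serve B \<omega> c \<sigma>' wss out" "length out = length wss"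
    "\<forall>t<length wss. fst (out ! t) \<le> f (Suc t) \<and> snd (out ! t) = g (Suc t)"
    by blast
  have "serve B \<omega> c \<sigma> (ws # wss) ((k, regs \<sigma>' 0) # out)"
    by (rule serve_Cons[OF 1(1) 2(1)])
  then show ?case using 1 2
    by (intro exI[of _ "(k, regs \<sigma>' 0) # out"]) (auto simp: less_Suc_eq_0_disj)
qed


section \<open>Measurability of events determined by finitely many coin flips\<close>

lemma prob_space_coin_space: "prob_space coin_space"
  unfolding coin_space_def by (intro prob_space_PiM measure_pmf.prob_space_axioms)

text \<open>The assumption says that \<open>S\<close> is open in Cantor space. The cylinders form a
  base indexed by the countable type \<open>bool list\<close>.\<close>

lemma sets_coin_space_if_locally_determined:
  assumes "\<And>\<omega>. \<omega> \<in> S \<Longrightarrow> \<exists>k. \<forall>\<omega>'. (\<forall>i<k. \<omega>' i = \<omega> i) \<longrightarrow> \<omega>' \<in> S"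
  shows "S \<in> sets coin_space"
proof -
  define cyl :: "bool list \<Rightarrow> (nat \<Rightarrow> bool) set" where "cyl l = {\<omega>. \<forall>i<length l. \<omega> i = l ! i}" for l
  have "cyl l \<in> sets coin_space" for l
  proof -
    have "Measurable.pred coin_space (\<lambda>\<omega>. \<forall>i<length l. \<omega> i = l ! i)"
      unfolding coin_space_def by measurable
    moreover have "space coin_space = UNIV" unfolding coin_space_def by (simp add: space_PiM)
    ultimately show ?thesis unfolding cyl_def by (auto simp: pred_def)
  qed
  then have "(\<Union>l\<in>{l. cyl l \<subseteq> S}. cyl l) \<in> sets coin_space"
    by (intro sets.countable_UN'') auto
  moreover have "S = (\<Union>l\<in>{l. cyl l \<subseteq> S}. cyl l)"
  proof
    show "S \<subseteq> (\<Union>l\<in>{l. cyl l \<subseteq> S}. cyl l)"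
    proof
      fix \<omega> assume "\<omega> \<in> S"
      then obtain k where k: "\<forall>\<omega>'. (\<forall>i<k. \<omega>' i = \<omega> i) \<longrightarrow> \<omega>' \<in> S" using assms by blast
      have "cyl (map \<omega> [0..<k]) \<subseteq> S" "\<omega> \<in> cyl (map \<omega> [0..<k])" using k by (auto simp: cyl_def)
      then show "\<omega> \<in> (\<Union>l\<in>{l. cyl l \<subseteq> S}. cyl l)" by blast
    qed
  qed blast
  ultimately show ?thesis by simp
qed

text \<open>A derivation is finite and consults \<open>\<omega>\<close> only at coin tosses, where a
  prefix of length \<open>tape_pos \<sigma> + 1\<close> suffices. Composite steps take the maximum
  of the prefixes of their parts.\<close>

lemma exec_locally_determined:
  "exec B \<omega> c \<sigma> t \<sigma>' \<Longrightarrow> \<exists>k. \<forall>\<omega>'. (\<forall>i<k. \<omega>' i = \<omega> i) \<longrightarrow> exec B \<omega>' c \<sigma> t \<sigma>'"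
proof (induction rule: exec.induct)
  case (exec_Coin r \<sigma>)
  have "exec B \<omega>' (Coin r) \<sigma> 1
      (\<sigma>\<lparr>regs := (regs \<sigma>)(r := of_bool (\<omega> (tape_pos \<sigma>))), tape_pos := tape_pos \<sigma> + 1\<rparr>)"
    if "\<forall>i<Suc (tape_pos \<sigma>). \<omega>' i = \<omega> i" for \<omega>'
    using exec.exec_Coin[of B \<omega>' r \<sigma>] that by simp
  then show ?case by blast
next
  case (exec_Seq c \<sigma> t \<sigma>' c' t' \<sigma>'')
  obtain k where k: "\<forall>\<omega>'. (\<forall>i<k. \<omega>' i = \<omega> i) \<longrightarrow> exec B \<omega>' c \<sigma> t \<sigma>'"
    using exec_Seq.IH(1) by (elim exE)
  obtain k' where k': "\<forall>\<omega>'. (\<forall>i<k'. \<omega>' i = \<omega> i) \<longrightarrow> exec B \<omega>' c' \<sigma>' t' \<sigma>''"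
    using exec_Seq.IH(2) by (elim exE)
  have "exec B \<omega>' (Seq c c') \<sigma> (t + t') \<sigma>''" if "\<forall>i<max k k'. \<omega>' i = \<omega> i" for \<omega>'
    using that k k' by (intro exec.exec_Seq[of _ _ _ _ _ \<sigma>']) auto
  then show ?case by blast
next
  case (exec_Loop_True \<sigma> e c t \<sigma>' t' \<sigma>'')
  obtain k where k: "\<forall>\<omega>'. (\<forall>i<k. \<omega>' i = \<omega> i) \<longrightarrow> exec B \<omega>' c \<sigma> t \<sigma>'"
    using exec_Loop_True.IH(1) by (elim exE)
  obtain k' where k': "\<forall>\<omega>'. (\<forall>i<k'. \<omega>' i = \<omega> i) \<longrightarrow> exec B \<omega>' (Loop e c) \<sigma>' t' \<sigma>''"
    using exec_Loop_True.IH(2) by (elim exE)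
  have "exec B \<omega>' (Loop e c) \<sigma> (cost e + 1 + t + t') \<sigma>''"
    if "\<forall>i<max k k'. \<omega>' i = \<omega> i" for \<omega>'
    using that k k' by (intro exec.exec_Loop_True[OF exec_Loop_True.hyps(1,2), of _ _ _ \<sigma>']) auto
  then show ?case by blast
qed (blast intro: exec.intros)+

lemma serve_locally_determined:
  "serve B \<omega> c \<sigma> wss out \<Longrightarrow>
     \<exists>k. \<forall>\<omega>'. (\<forall>i<k. \<omega>' i = \<omega> i) \<longrightarrow> serve B \<omega>' c \<sigma> wss out"
proof (induction rule: serve.induct)
  case (serve_Cons ws \<sigma> t \<sigma>' wss out)
  obtain k where k: "\<forall>\<omega>'. (\<forall>i<k. \<omega>' i = \<omega> i) \<longrightarrow> exec B \<omega>' c (put_request ws \<sigma>) t \<sigma>'"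
    using exec_locally_determined[OF serve_Cons.hyps(1)] by (elim exE)
  obtain k' where k': "\<forall>\<omega>'. (\<forall>i<k'. \<omega>' i = \<omega> i) \<longrightarrow> serve B \<omega>' c \<sigma>' wss out"
    using serve_Cons.IH by (elim exE)
  have "serve B \<omega>' c \<sigma> (ws # wss) ((t, regs \<sigma>' 0) # out)" if "\<forall>i<max k k'. \<omega>' i = \<omega> i" for \<omega>'
    using that k k' by (intro serve.serve_Cons) auto
  then show ?case by blast
qed (blast intro: serve.intros)

text \<open>\<open>R\<close> may be arbitrary: the witness \<open>t0\<close>, \<open>out\<close>
  stays the same for all tapes that share the prefix.\<close>

lemma sets_online_run:
  "{\<omega>. \<exists>t0 out. online_run B \<omega> alg \<sigma> wss t0 out \<and> R t0 out} \<in> sets coin_space"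
proof (rule sets_coin_space_if_locally_determined)
  fix \<omega> assume "\<omega> \<in> {\<omega>. \<exists>t0 out. online_run B \<omega> alg \<sigma> wss t0 out \<and> R t0 out}"
  then obtain t0 out \<sigma>' where 1: "exec B \<omega> (preprocess alg) \<sigma> t0 \<sigma>'"
    "serve B \<omega> (respond alg) \<sigma>' wss out" "R t0 out"
    unfolding online_run_def by blast
  obtain k where k: "\<forall>\<omega>'. (\<forall>i<k. \<omega>' i = \<omega> i) \<longrightarrow> exec B \<omega>' (preprocess alg) \<sigma> t0 \<sigma>'"
    using exec_locally_determined[OF 1(1)] by (elim exE)
  obtain k' where k': "\<forall>\<omega>'. (\<forall>i<k'. \<omega>' i = \<omega> i) \<longrightarrow> serve B \<omega>' (respond alg) \<sigma>' wss out"
    using serve_locally_determined[OF 1(2)] by (elim exE)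
  have "online_run B \<omega>' alg \<sigma> wss t0 out" if "\<forall>i<max k k'. \<omega>' i = \<omega> i" for \<omega>'
    using that k k' unfolding online_run_def by (intro exI[of _ \<sigma>']) auto
  then show "\<exists>k. \<forall>\<omega>'. (\<forall>i<k. \<omega>' i = \<omega> i) \<longrightarrow>
      \<omega>' \<in> {\<omega>. \<exists>t0 out. online_run B \<omega> alg \<sigma> wss t0 out \<and> R t0 out}"
    using 1(3) by blast
qed


section \<open>Embedding a program into a larger memory\<close>

text \<open>The embedded program (the guest) leaves registers 0 to 7 and arrays 0 to 2 to its host.\<close>

fun shift_expr :: "expr \<Rightarrow> expr" where
  "shift_expr (Lit k) = Lit k"
| "shift_expr (Reg r) = Reg (r + 8)"
| "shift_expr (Arr a e) = Arr (a + 3) (shift_expr e)"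
| "shift_expr (Bin f e e') = Bin f (shift_expr e) (shift_expr e')"

fun shift_com :: "com \<Rightarrow> com" where
  "shift_com Skip = Skip"
| "shift_com (Assign r e) = Assign (r + 8) (shift_expr e)"
| "shift_com (Store a i e) = Store (a + 3) (shift_expr i) (shift_expr e)"
| "shift_com (Coin r) = Coin (r + 8)"
| "shift_com (Seq c c') = Seq (shift_com c) (shift_com c')"
| "shift_com (Cond e c c') = Cond (shift_expr e) (shift_com c) (shift_com c')"
| "shift_com (Loop e c) = Loop (shift_expr e) (shift_com c)"

text \<open>\<open>tape_pos\<close> is shared rather than split, so the guest reads exactly the bits
  that it would read when run alone on the same tape.\<close>

definition guest :: "state \<Rightarrow> state" where
  "guest \<sigma> = \<lparr>regs = (\<lambda>r. regs \<sigma> (r + 8)), arrs = (\<lambda>a. arrs \<sigma> (a + 3)), tape_pos = tape_pos \<sigma>\<rparr>"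

definition same_host :: "state \<Rightarrow> state \<Rightarrow> bool" where
  "same_host \<sigma> \<sigma>' \<longleftrightarrow> (\<forall>r<8. regs \<sigma>' r = regs \<sigma> r) \<and> (\<forall>a<3. arrs \<sigma>' a = arrs \<sigma> a)"

lemma eval_shift: "eval \<sigma> (shift_expr e) = eval (guest \<sigma>) e"
  by (induction e) (auto simp: guest_def)

lemma fits_shift: "fits B (guest \<sigma>) e \<Longrightarrow> B \<le> B' \<Longrightarrow> fits B' \<sigma> (shift_expr e)"
  by (induction e) (auto simp: guest_def eval_shift)

lemma cost_shift: "cost (shift_expr e) = cost e"
  by (induction e) auto

text \<open>The renaming is injective and changes neither costs nor branches, so even the time
  \<open>t\<close> is preserved. A larger word bound only relaxes \<open>fits\<close>.\<close>

lemma exec_shift: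
  assumes "exec B \<omega> c \<tau> t \<tau>'" and "B \<le> B'" and "guest \<sigma> = \<tau>"
  shows "\<exists>\<sigma>'. exec B' \<omega> (shift_com c) \<sigma> t \<sigma>' \<and> guest \<sigma>' = \<tau>' \<and> same_host \<sigma> \<sigma>'"
  using assms
proof (induction arbitrary: \<sigma> rule: exec.induct)
  case (exec_Skip \<tau>)
  then show ?case by (auto simp: same_host_def simp del: One_nat_def intro!: exec.exec_Skip)
next
  case (exec_Assign \<tau> e r)
  then have "exec B' \<omega> (Assign (r + 8) (shift_expr e)) \<sigma> (cost (shift_expr e) + 1)
     (\<sigma>\<lparr>regs := (regs \<sigma>)(r + 8 := eval \<sigma> (shift_expr e))\<rparr>)"
    by (intro exec.exec_Assign fits_shift) auto
  then show ?case using exec_Assign.prems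
    by (intro exI[of _ "\<sigma>\<lparr>regs := (regs \<sigma>)(r + 8 := eval \<sigma> (shift_expr e))\<rparr>"])
       (auto simp: cost_shift eval_shift same_host_def guest_def fun_eq_iff)
next
  case (exec_Store \<tau> i e a)
  let ?\<sigma> = "\<sigma>\<lparr>arrs := (arrs \<sigma>)(a + 3 := (arrs \<sigma> (a + 3))(eval \<sigma> (shift_expr i) := eval \<sigma> (shift_expr e)))\<rparr>"
  have "exec B' \<omega> (Store (a + 3) (shift_expr i) (shift_expr e)) \<sigma>
     (cost (shift_expr i) + cost (shift_expr e) + 1) ?\<sigma>"
    using exec_Store by (intro exec.exec_Store fits_shift) auto
  then show ?case using exec_Store.prems
    by (intro exI[of _ ?\<sigma>])
       (auto simp: cost_shift eval_shift same_host_def guest_def fun_eq_iff)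
next
  case (exec_Coin r \<tau>)
  let ?\<sigma> = "\<sigma>\<lparr>regs := (regs \<sigma>)(r + 8 := of_bool (\<omega> (tape_pos \<sigma>))), tape_pos := tape_pos \<sigma> + 1\<rparr>"
  have "exec B' \<omega> (Coin (r + 8)) \<sigma> 1 ?\<sigma>" by (rule exec.exec_Coin)
  then show ?case using exec_Coin.prems
    by (intro exI[of _ ?\<sigma>]) (auto simp: same_host_def guest_def fun_eq_iff)
next
  case (exec_Seq c \<tau> t \<tau>' c' t' \<tau>'')
  then obtain \<sigma>' where 1: "exec B' \<omega> (shift_com c) \<sigma> t \<sigma>'" "guest \<sigma>' = \<tau>'" "same_host \<sigma> \<sigma>'"
    by blast
  from exec_Seq.IH(2)[OF exec_Seq.prems(1) 1(2)] obtain \<sigma>'' where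
    2: "exec B' \<omega> (shift_com c') \<sigma>' t' \<sigma>''" "guest \<sigma>'' = \<tau>''" "same_host \<sigma>' \<sigma>''"
    by blast
  show ?case using exec.exec_Seq[OF 1(1) 2(1)] 1 2 by (auto simp: same_host_def)
next
  case (exec_Cond_True \<tau> e c t \<tau>' c')
  then obtain \<sigma>' where 1: "exec B' \<omega> (shift_com c) \<sigma> t \<sigma>'" "guest \<sigma>' = \<tau>'" "same_host \<sigma> \<sigma>'"
    by blast
  have "exec B' \<omega> (shift_com (Cond e c c')) \<sigma> (cost (shift_expr e) + 1 + t) \<sigma>'"
    unfolding shift_com.simps
    by (rule exec.exec_Cond_True[OF _ _ 1(1)]) (use exec_Cond_True in \<open>auto simp: eval_shift fits_shift\<close>)
  then show ?case using 1 by (auto simp: cost_shift)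
next
  case (exec_Cond_False \<tau> e c' t \<tau>' c)
  then obtain \<sigma>' where 1: "exec B' \<omega> (shift_com c') \<sigma> t \<sigma>'" "guest \<sigma>' = \<tau>'" "same_host \<sigma> \<sigma>'"
    by blast
  have "exec B' \<omega> (shift_com (Cond e c c')) \<sigma> (cost (shift_expr e) + 1 + t) \<sigma>'"
    unfolding shift_com.simps
    by (rule exec.exec_Cond_False[OF _ _ 1(1)]) (use exec_Cond_False in \<open>auto simp: eval_shift fits_shift\<close>)
  then show ?case using 1 by (auto simp: cost_shift)
next
  case (exec_Loop_False \<tau> e c)
  have "exec B' \<omega> (shift_com (Loop e c)) \<sigma> (cost (shift_expr e) + 1) \<sigma>"
    unfolding shift_com.simps
    by (rule exec.exec_Loop_False) (use exec_Loop_False in \<open>auto simp: eval_shift fits_shift\<close>)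
  then show ?case using exec_Loop_False.prems by (auto simp: cost_shift same_host_def)
next
  case (exec_Loop_True \<tau> e c t \<tau>' t' \<tau>'')
  then obtain \<sigma>' where 1: "exec B' \<omega> (shift_com c) \<sigma> t \<sigma>'" "guest \<sigma>' = \<tau>'" "same_host \<sigma> \<sigma>'"
    by blast
  from exec_Loop_True.IH(2)[OF exec_Loop_True.prems(1) 1(2)] obtain \<sigma>'' where
    2: "exec B' \<omega> (Loop (shift_expr e) (shift_com c)) \<sigma>' t' \<sigma>''" "guest \<sigma>'' = \<tau>''" "same_host \<sigma>' \<sigma>''"
    by auto
  have "exec B' \<omega> (shift_com (Loop e c)) \<sigma> (cost (shift_expr e) + 1 + t + t') \<sigma>''"
    unfolding shift_com.simps
    by (rule exec.exec_Loop_True[OF _ _ 1(1) 2(1)])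
       (use exec_Loop_True in \<open>auto simp: eval_shift fits_shift\<close>)
  then show ?case using 1 2 by (auto simp: cost_shift same_host_def)
qed

lemma wp_shift:
  assumes "exec B \<omega> c (guest \<sigma>) t \<tau>'" and "B \<le> B'"
    and "\<And>\<sigma>'. guest \<sigma>' = \<tau>' \<Longrightarrow> same_host \<sigma> \<sigma>' \<Longrightarrow> R t \<sigma>'"
  shows "wp B' \<omega> (shift_com c) R \<sigma>"
  using exec_shift[OF assms(1,2) refl] assms(3) unfolding wp_def by blast


section \<open>The reduction\<close>

text \<open>
  Vertex 0 is \<open>s\<close>, the vertices \<open>i + 1\<close> and \<open>n + 1 + j\<close> for \<open>i, j < n\<close> stand for the rows and
  columns of \<open>M\<close>, and \<open>2n + 1\<close> is the dummy vertex. Position \<open>t (2n + 1) + k\<close> of the request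
  sequence belongs to round \<open>t\<close>; it sets coordinate \<open>k\<close> of the concatenation of the two vectors
  if \<open>k < 2n\<close>, and it is the query of that round if \<open>k = 2n\<close>.
\<close>

definition oumv_graph :: "nat \<Rightarrow> (nat \<Rightarrow> nat \<Rightarrow> bool) \<Rightarrow> nat set set" where
  "oumv_graph n M = {{i + 1, n + 1 + j} | i j. i < n \<and> j < n \<and> M i j}"

definition oumv_predict :: "nat \<Rightarrow> nat \<Rightarrow> request list" where
  "oumv_predict n p = (let k = p mod (2 * n + 1) in
     if k < 2 * n then [Flip {0, k + 1}, Flip {0, 2 * n + 1}] else [Query])"

definition oumv_predictions :: "nat \<Rightarrow> request list list" where
  "oumv_predictions n = map (oumv_predict n) [0..<n * (2 * n + 1)]"

text \<open>In the concatenation, coordinate \<open>k\<close> belongs to vertex \<open>k + 1\<close>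
  for rows and columns alike, since column \<open>j\<close> is coordinate \<open>n + j\<close> and
  vertex \<open>n + 1 + j\<close>.\<close>

definition coord :: "nat \<Rightarrow> (nat \<Rightarrow> bool) \<times> (nat \<Rightarrow> bool) \<Rightarrow> nat \<Rightarrow> bool" where
  "coord n uv k = (if k < n then fst uv k else snd uv (k - n))"

text \<open>The guard \<open>t > 0\<close> makes the vectors before the first round zero, in
  accordance with the initial graph, which has no edge at vertex 0.\<close>

definition prev_coord ::
  "nat \<Rightarrow> ((nat \<Rightarrow> bool) \<times> (nat \<Rightarrow> bool)) list \<Rightarrow> nat \<Rightarrow> nat \<Rightarrow> bool" where
  "prev_coord n uvs t k \<longleftrightarrow> t > 0 \<and> coord n (uvs ! (t - 1)) k"

definition oumv_requests :: "nat \<Rightarrow> ((nat \<Rightarrow> bool) \<times> (nat \<Rightarrow> bool)) list \<Rightarrow> request list" where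
  "oumv_requests n uvs =
     map (\<lambda>p. let t = p div (2 * n + 1); k = p mod (2 * n + 1) in
            if k < 2 * n
            then Flip {0, if coord n (uvs ! t) k \<noteq> prev_coord n uvs t k then k + 1 else 2 * n + 1}
            else Query)
       [0..<n * (2 * n + 1)]"

lemma length_oumv_predictions: "length (oumv_predictions n) = n * (2 * n + 1)"
  by (simp add: oumv_predictions_def)

lemma length_oumv_requests: "length (oumv_requests n uvs) = n * (2 * n + 1)"
  by (simp add: oumv_requests_def)

lemma position_less:
  fixes t k n :: nat
  assumes "t < n" "k \<le> 2 * n"
  shows "t * (2 * n + 1) + k < n * (2 * n + 1)"
proof -
  have "t * (2 * n + 1) + k < Suc t * (2 * n + 1)" using assms by simp
  also have "\<dots> \<le> n * (2 * n + 1)" using assms by (intro mult_le_mono1) simp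
  finally show ?thesis .
qed

lemma oumv_requests_nth:
  assumes "t < n" "k \<le> 2 * n"
  shows "oumv_requests n uvs ! (t * (2 * n + 1) + k) =
    (if k < 2 * n
     then Flip {0, if coord n (uvs ! t) k \<noteq> prev_coord n uvs t k then k + 1 else 2 * n + 1}
     else Query)"
proof -
  have "(t * m + k) div m = t" "(t * m + k) mod m = k" if "k < m" for m
    using that by simp_all
  from this[of "2 * n + 1"] show ?thesis
    using position_less[OF assms] assms(2) unfolding oumv_requests_def Let_def
    by (simp del: mult_Suc_right add_Suc_right)
qed

lemma doubleton_in_all_edges: "u < n \<Longrightarrow> v < n \<Longrightarrow> u \<noteq> v \<Longrightarrow> {u, v} \<in> all_edges n"
  unfolding all_edges_def by blast

lemma oumv_graph_subset: "oumv_graph n M \<subseteq> all_edges (2 * n + 2)"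
  unfolding oumv_graph_def by (auto intro!: doubleton_in_all_edges)

lemma oumv_predictions_valid:
  assumes "p \<in> set (oumv_predictions n)"
  shows "distinct p" "set p \<subseteq> requests (2 * n + 2)" "card (set p) \<le> 2"
proof -
  from assms obtain q where q: "p = oumv_predict n q" unfolding oumv_predictions_def by auto
  show "distinct p" "set p \<subseteq> requests (2 * n + 2)"
    unfolding q oumv_predict_def Let_def requests_def
    by (auto simp: doubleton_eq_iff intro!: doubleton_in_all_edges imageI)
  show "card (set p) \<le> 2"
    by (rule order_trans[OF card_length]) (auto simp: q oumv_predict_def Let_def)
qed

lemma oumv_requests_accurate:
  "list_accurate 2 (map set (oumv_predictions n)) {oumv_requests n uvs}"
  unfolding list_accurate_def
proof (rule conjI; rule ballI)
  fix R assume "R \<in> set (map set (oumv_predictions n))"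
  then show "finite R \<and> card R \<le> 2" using oumv_predictions_valid(3) by auto
next
  fix \<rho> assume "\<rho> \<in> {oumv_requests n uvs}"
  then show "length \<rho> = length (map set (oumv_predictions n)) \<and>
     (\<forall>t<length (map set (oumv_predictions n)). \<rho> ! t \<in> map set (oumv_predictions n) ! t)"
    by (auto simp: oumv_requests_def oumv_predictions_def oumv_predict_def Let_def)
qed

lemma apply_request_subset:
  "r \<in> requests n \<Longrightarrow> G \<subseteq> all_edges n \<Longrightarrow> apply_request r G \<subseteq> all_edges n"
  by (cases r) (auto simp: requests_def)

lemma fold_apply_request_subset:
  "set \<rho> \<subseteq> requests n \<Longrightarrow> G \<subseteq> all_edges n \<Longrightarrow> fold apply_request \<rho> G \<subseteq> all_edges n"
proof (induction \<rho> arbitrary: G)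
  case (Cons r \<rho>)
  then have "apply_request r G \<subseteq> all_edges n" by (intro apply_request_subset) auto
  with Cons show ?case by simp
qed simp

lemma set_oumv_requests: "set (oumv_requests n uvs) \<subseteq> requests (2 * n + 2)"
  unfolding oumv_requests_def Let_def requests_def
  by (auto intro!: doubleton_in_all_edges imageI split: if_splits)

lemma zero_notin_oumv_graph: "e \<in> oumv_graph n M \<Longrightarrow> 0 \<notin> e"
  unfolding oumv_graph_def by auto

section \<open>How the edges at \<open>s\<close> evolve during the rounds\<close>

definition graph_at ::
  "nat \<Rightarrow> (nat \<Rightarrow> nat \<Rightarrow> bool) \<Rightarrow> ((nat \<Rightarrow> bool) \<times> (nat \<Rightarrow> bool)) list \<Rightarrow> nat \<Rightarrow> nat \<Rightarrow> nat set set" where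
  "graph_at n M uvs t k =
     fold apply_request (take (t * (2 * n + 1) + k) (oumv_requests n uvs)) (oumv_graph n M)"

lemma graph_at_0: "graph_at n M uvs 0 0 = oumv_graph n M"
  by (simp add: graph_at_def)

lemma graph_at_step:
  assumes "t < n" "k \<le> 2 * n"
  shows "graph_at n M uvs t (Suc k) =
    apply_request (oumv_requests n uvs ! (t * (2 * n + 1) + k)) (graph_at n M uvs t k)"
  using position_less[OF assms]
  by (simp add: graph_at_def take_Suc_conv_app_nth length_oumv_requests)

lemma graph_at_next_round:
  assumes "t < n"
  shows "graph_at n M uvs (Suc t) 0 = graph_at n M uvs t (2 * n)"
proof -
  have "graph_at n M uvs (Suc t) 0 = graph_at n M uvs t (Suc (2 * n))"
    by (simp add: graph_at_def ac_simps)
  also have "\<dots> = graph_at n M uvs t (2 * n)"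
    using assms by (simp only: graph_at_step order_refl oumv_requests_nth) simp
  finally show ?thesis .
qed

lemma graph_at_subset: "graph_at n M uvs t k \<subseteq> all_edges (2 * n + 2)"
  unfolding graph_at_def
  by (intro fold_apply_request_subset oumv_graph_subset
      subset_trans[OF set_take_subset set_oumv_requests])

text \<open>The index is a coordinate, not a vertex; \<open>spoke (2 * n)\<close> is the edge to the
  dummy vertex.\<close>

definition spoke :: "nat \<Rightarrow> nat set" where
  "spoke i = {0, i + 1}"

lemma spoke_eq_iff: "spoke i = spoke j \<longleftrightarrow> i = j"
  by (auto simp: spoke_def doubleton_eq_iff)

lemma spoke_notin_oumv_graph: "spoke i \<notin> oumv_graph n M"
  using zero_notin_oumv_graph by (auto simp: spoke_def)

text \<open>In the middle of a round the coordinates below \<open>k\<close> are already new and the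
  others still old. The dummy edge is excluded because its presence depends on the parity of the
  number of unchanged coordinates so far, which need not be tracked.\<close>

lemma mem_graph_at:
  assumes "t < n" "k \<le> 2 * n" "e \<noteq> spoke (2 * n)"
  shows "e \<in> graph_at n M uvs t k \<longleftrightarrow> e \<in> oumv_graph n M \<or>
    (\<exists>i<2 * n. e = spoke i \<and> (if i < k then coord n (uvs ! t) i else prev_coord n uvs t i))"
    (is "?S t k")
proof -
  have step: "?S t (Suc k)" if "t < n" "k < 2 * n" "?S t k" for t k
  proof -
    let ?c = "coord n (uvs ! t) k \<noteq> prev_coord n uvs t k"
    have H: "graph_at n M uvs t (Suc k) =
        apply_request (Flip (if ?c then spoke k else spoke (2 * n))) (graph_at n M uvs t k)"
      using that by (simp add: graph_at_step oumv_requests_nth[simplified] spoke_def)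
    show ?thesis
    proof (cases "e = spoke k")
      case True
      \<comment> \<open>Spoke \<open>k\<close> has not been touched in this round. Flipping it
        exactly when old and new values differ leaves the new value.\<close>
      have "e \<in> graph_at n M uvs t k \<longleftrightarrow> prev_coord n uvs t k"
        unfolding that(3) using True that(2) by (auto simp: spoke_eq_iff spoke_notin_oumv_graph)
      then have "e \<in> graph_at n M uvs t (Suc k) \<longleftrightarrow> coord n (uvs ! t) k"
        unfolding H using True assms(3) by auto
      then show ?thesis
        using True that(2) by (auto simp: spoke_eq_iff spoke_notin_oumv_graph)
    next
      case False
      then have "e \<in> graph_at n M uvs t (Suc k) \<longleftrightarrow> e \<in> graph_at n M uvs t k"
        unfolding H using assms(3) by auto
      then show ?thesis unfolding that(3) using False by (metis less_Suc_eq)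
    qed
  qed
  have steps: "?S t k" if "t < n" "?S t 0" "k \<le> 2 * n" for t k
    using that(3)
  proof (induction k)
    case 0
    show ?case by (rule that)
  next
    case (Suc k)
    then have "?S t k" by simp
    then show ?case by (rule step[rotated 2]) (use that(1) Suc.prems in auto)
  qed
  have "?S t 0" if "t < n" for t
    using that
  proof (induction t)
    case 0
    show ?case by (simp add: graph_at_0 prev_coord_def)
  next
    case (Suc t)
    then have "?S t 0" by simp
    then have "?S t (2 * n)" by (rule steps[rotated]) (use Suc.prems in auto)
    \<comment> \<open>The query changes nothing, and \<open>prev_coord\<close> of round
      \<open>Suc t\<close> is by definition \<open>coord\<close> of round \<open>t\<close>.\<close>
    then show ?case using Suc.prems by (auto simp: graph_at_next_round prev_coord_def)
  qed
  from steps[OF assms(1) this[OF assms(1)] assms(2)] show ?thesis .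
qed

section \<open>Triangles through \<open>s\<close> and the value of the Boolean form\<close>

lemma finite_triangles_at:
  assumes "G \<subseteq> all_edges n"
  shows "finite (triangles_at s G)"
proof (rule finite_subset)
  show "triangles_at s G \<subseteq> Pow {..<n}"
  proof (intro subsetI PowI)
    fix X u assume X: "X \<in> triangles_at s G" and "u \<in> X"
    then have "card X = 3" by (simp add: triangles_at_def)
    \<comment> \<open>A vertex of a triangle has a neighbour in it, so it lies on an edge of
      \<open>G\<close>, and all ends of such edges are below \<open>n\<close>.\<close>
    then have "card (X - {u}) \<noteq> 0" using \<open>u \<in> X\<close> by (simp add: card_Diff_singleton)
    then obtain v where "v \<in> X" "v \<noteq> u" by (metis card.empty equals0I Diff_iff insertCI)
    then have "{u, v} \<in> all_edges n" using X \<open>u \<in> X\<close> assms by (auto simp: triangles_at_def)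
    then show "u \<in> {..<n}" by (auto simp: all_edges_def doubleton_eq_iff)
  qed
qed simp

text \<open>In a triangle through 0 the opposite edge avoids 0, so it is no spoke and must be a
  matrix edge between some row \<open>i\<close> and column \<open>j\<close>. The other two sides are
  the spokes of coordinates \<open>i\<close> and \<open>n + j\<close>, both below
  \<open>2 * n\<close>, so the unknown status of the dummy edge has no influence.\<close>

lemma triangle_iff_uMv:
  assumes edges: "\<And>e. e \<noteq> spoke (2 * n) \<Longrightarrow>
      e \<in> H \<longleftrightarrow> e \<in> oumv_graph n M \<or> (\<exists>i<2 * n. e = spoke i \<and> coord n uv i)"
  shows "triangles_at 0 H \<noteq> {} \<longleftrightarrow> bool_uMv n M (fst uv) (snd uv)"
proof
  assume "triangles_at 0 H \<noteq> {}"
  then obtain X where X: "card X = 3" "0 \<in> X" "\<And>u v. u \<in> X \<Longrightarrow> v \<in> X \<Longrightarrow> u \<noteq> v \<Longrightarrow> {u, v} \<in> H"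
    unfolding triangles_at_def by blast
  have "card (X - {0}) = 2" using X by (simp add: card_Diff_singleton)
  then obtain x y where xy: "X - {0} = {x, y}" "x \<noteq> y" by (auto simp: card_2_iff)
  have "x \<in> X - {0}" "y \<in> X - {0}" unfolding xy(1) by simp_all
  then have nz: "x \<noteq> 0" "y \<noteq> 0" "x \<in> X" "y \<in> X" by simp_all
  have "{x, y} \<in> H" by (rule X(3)[OF nz(3,4) xy(2)])
  moreover have "{x, y} \<noteq> spoke i" for i using nz by (auto simp: spoke_def doubleton_eq_iff)
  ultimately have "{x, y} \<in> oumv_graph n M" using edges[of "{x, y}"] by simp
  then obtain i j where ij: "i < n" "j < n" "M i j" "{x, y} = {i + 1, n + 1 + j}"
    unfolding oumv_graph_def by (elim CollectE exE conjE)
  have *: "coord n uv k" if "k < 2 * n" "k + 1 \<in> {x, y}" for k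
  proof -
    have "k + 1 \<in> X" using that(2) nz by blast
    then have "spoke k \<in> H" unfolding spoke_def by (intro X) simp_all
    moreover have "spoke k \<noteq> spoke (2 * n)" using that by (simp add: spoke_eq_iff)
    ultimately show ?thesis
      using edges[of "spoke k"] by (simp add: spoke_eq_iff spoke_notin_oumv_graph)
  qed
  have "coord n uv i" "coord n uv (n + j)" using ij(1,2) unfolding ij(4) by (auto intro!: *[unfolded ij(4)])
  then show "bool_uMv n M (fst uv) (snd uv)" using ij(1-3) by (auto simp: bool_uMv_def coord_def)
next
  assume "bool_uMv n M (fst uv) (snd uv)"
  then obtain i j where ij: "i < n" "j < n" "M i j" "coord n uv i" "coord n uv (n + j)"
    by (auto simp: bool_uMv_def coord_def)
  have "spoke i \<in> H" "spoke (n + j) \<in> H"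
    using ij edges[of "spoke i"] edges[of "spoke (n + j)"] by (auto simp: spoke_eq_iff)
  moreover have "{i + 1, n + 1 + j} \<in> H"
  proof (subst edges)
    show "{i + 1, n + 1 + j} \<noteq> spoke (2 * n)" by (auto simp: spoke_def doubleton_eq_iff)
    show "{i + 1, n + 1 + j} \<in> oumv_graph n M \<or>
      (\<exists>k<2 * n. {i + 1, n + 1 + j} = spoke k \<and> coord n uv k)"
      using ij by (auto simp: oumv_graph_def)
  qed
  ultimately have "{0, i + 1, n + 1 + j} \<in> triangles_at 0 H"
    using ij by (auto simp: triangles_at_def spoke_def insert_commute)
  then show "triangles_at 0 H \<noteq> {}" by blast
qed

lemma card_triangles_iff_uMv:
  assumes "t < n"
  shows "card (triangles_at 0 (graph_at n M uvs t (2 * n))) > 0 \<longleftrightarrow>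
    bool_uMv n M (fst (uvs ! t)) (snd (uvs ! t))"
proof -
  \<comment> \<open>\<open>card\<close> is 0 on infinite sets, so a nonempty set of triangles gives
    a positive count only because it is finite.\<close>
  have "finite (triangles_at 0 (graph_at n M uvs t (2 * n)))"
    by (rule finite_triangles_at[OF graph_at_subset])
  moreover have "triangles_at 0 (graph_at n M uvs t (2 * n)) \<noteq> {} \<longleftrightarrow>
      bool_uMv n M (fst (uvs ! t)) (snd (uvs ! t))"
    by (rule triangle_iff_uMv) (use mem_graph_at[OF assms order_refl] in auto)
  ultimately show ?thesis by (simp add: card_gt_0_iff)
qed


section \<open>The program of the reduction\<close>

text \<open>Row-major order with the two indices recovered by division; a single loop counter can
  then produce the cells.\<close>

lemma concat_map_upt:
  "concat (map (\<lambda>u. map (f u) [0..<n]) [0..<m]) = map (\<lambda>q. f (q div n) (q mod n)) [0..<m * n]"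
proof (induction m)
  case (Suc m)
  have "map (f m) [0..<n] = map (\<lambda>q. f (q div n) (q mod n)) [m * n..<m * n + n]"
    by (rule nth_equalityI) auto
  moreover have "[0..<Suc m * n] = [0..<m * n] @ [m * n..<m * n + n]"
    using upt_add_eq_append[of 0 "m * n" n] by (simp add: add.commute)
  ultimately show ?case using Suc by simp
qed simp

lemma nth_default_map_upt: "nth_default 0 (map f [0..<m]) = (\<lambda>q. if q < m then f q else 0)"
  by (auto simp: nth_default_def)

lemma nth_default_snoc: "nth_default 0 (xs @ [x]) = (nth_default 0 xs)(length xs := x)"
  by (auto simp: nth_default_def nth_append fun_eq_iff)

lemma encode_graph_eq:
  "encode_graph n G = map (\<lambda>q. of_bool ({q div n, q mod n} \<in> G)) [0..<n * n]"
  unfolding encode_graph_def by (rule concat_map_upt)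

lemma encode_matrix_eq:
  "concat (map (\<lambda>i. encode_vec n (M i)) [0..<n]) =
     map (\<lambda>q. of_bool (M (q div n) (q mod n))) [0..<n * n]"
  unfolding encode_vec_def by (rule concat_map_upt)

text \<open>The form that the program can test: strict comparisons for an ordered pair, tried in
  both orders because edges are unordered.\<close>

lemma mem_oumv_graph:
  "{u, v} \<in> oumv_graph n M \<longleftrightarrow>
     (0 < u \<and> u < n + 1 \<and> n < v \<and> v < 2 * n + 1 \<and> M (u - 1) (v - (n + 1))) \<or>
     (0 < v \<and> v < n + 1 \<and> n < u \<and> u < 2 * n + 1 \<and> M (v - 1) (u - (n + 1)))"
    (is "_ \<longleftrightarrow> ?R u v \<or> ?R v u")
proof
  assume "{u, v} \<in> oumv_graph n M"
  then show "?R u v \<or> ?R v u" by (auto simp: oumv_graph_def doubleton_eq_iff)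
next
  have *: "{u, v} \<in> oumv_graph n M" if "?R u v" for u v
  proof -
    have "{u, v} = {(u - 1) + 1, n + 1 + (v - (n + 1))}" using that by auto
    moreover have "u - 1 < n" "v - (n + 1) < n" using that by auto
    ultimately show ?thesis unfolding oumv_graph_def using that by blast
  qed
  assume "?R u v \<or> ?R v u"
  then show "{u, v} \<in> oumv_graph n M" using *[of u v] *[of v u] by (auto simp: insert_commute)
qed

text \<open>
  Host registers: 1 holds \<open>n\<close>, 2 a modulus, 3 and 4 a loop counter and its bound, 5 the position of the
  next prediction to be written. Array 1 holds \<open>M\<close> and array 2 the previous pair of vectors. The
  guest sees array 3 as its request, 4 as its graph and 5 as its predictions, and register 8 as its
  answer.
\<close>

definition edge_guard :: "expr \<Rightarrow> expr \<Rightarrow> expr" where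
  "edge_guard u v =
     Bin Mul (Bin Mul (Bin Less (Lit 0) u) (Bin Less u (Bin Add (Reg 1) (Lit 1))))
       (Bin Mul (Bin Less (Reg 1) v) (Bin Less v (Bin Add (Bin Mul (Lit 2) (Reg 1)) (Lit 1))))"

definition matrix_entry :: "expr \<Rightarrow> expr \<Rightarrow> expr" where
  "matrix_entry u v =
     Arr 1 (Bin Add (Bin Mul (Bin Sub u (Lit 1)) (Reg 1)) (Bin Sub v (Bin Add (Reg 1) (Lit 1))))"

text \<open>Non-edges are not written, as the target array starts at zero. The entry of
  \<open>M\<close> is read only under a guard, which keeps the index within the matrix.\<close>

definition graph_body :: com where
  "graph_body =
     (let u = Bin Div (Reg 3) (Reg 2); v = Bin Mod (Reg 3) (Reg 2) in
      Seq (Cond (edge_guard u v) (Store 4 (Reg 3) (matrix_entry u v))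
            (Cond (edge_guard v u) (Store 4 (Reg 3) (matrix_entry v u)) Skip))
          (Assign 3 (Bin Add (Reg 3) (Lit 1))))"

definition graph_com :: com where
  "graph_com =
     Seq (Assign 1 (Reg 0))
    (Seq (Assign 2 (Bin Add (Bin Mul (Lit 2) (Reg 1)) (Lit 2)))
    (Seq (Assign 3 (Lit 0))
    (Seq (Assign 4 (Bin Mul (Reg 2) (Reg 2)))
         (Loop (Bin Less (Reg 3) (Reg 4)) graph_body))))"

lemma cost_edge_guard: "cost (edge_guard u v) = 2 * cost u + 2 * cost v + 17"
  by (simp add: edge_guard_def)

lemma cost_matrix_entry: "cost (matrix_entry u v) = cost u + cost v + 10"
  by (simp add: matrix_entry_def)

text \<open>Products of truth values act as conjunctions. The bound \<open>2 * n + 2\<close> rather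
  than \<open>2 * n + 1\<close> also covers the literal 2 when \<open>n = 0\<close>.\<close>

lemma edge_guard:
  assumes "regs \<sigma> 1 = n" "fits B \<sigma> u" "fits B \<sigma> v" "2 * n + 2 \<le> B"
  shows "fits B \<sigma> (edge_guard u v)"
    "eval \<sigma> (edge_guard u v) \<noteq> 0 \<longleftrightarrow>
       0 < eval \<sigma> u \<and> eval \<sigma> u < n + 1 \<and> n < eval \<sigma> v \<and> eval \<sigma> v < 2 * n + 1"
  using assms by (auto simp: edge_guard_def)

text \<open>Under the guard the truncated subtractions are exact, and the row-major index stays
  below \<open>n * n\<close>.\<close>

lemma matrix_entry:
  assumes "regs \<sigma> 1 = n" "fits B \<sigma> u" "fits B \<sigma> v" "2 * n + 2 \<le> B" "n * n \<le> B"
    and arr: "arrs \<sigma> 1 = nth_default 0 (map (\<lambda>q. of_bool (M (q div n) (q mod n))) [0..<n * n])"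
    and uv: "0 < eval \<sigma> u" "eval \<sigma> u < n + 1" "n < eval \<sigma> v" "eval \<sigma> v < 2 * n + 1"
  shows "fits B \<sigma> (matrix_entry u v)"
    "eval \<sigma> (matrix_entry u v) = of_bool (M (eval \<sigma> u - 1) (eval \<sigma> v - (n + 1)))"
proof -
  define i j where "i = eval \<sigma> u - 1" and "j = eval \<sigma> v - (n + 1)"
  have ij: "i < n" "j < n" using uv by (auto simp: i_def j_def)
  have "i * n + j < Suc i * n" using ij by simp
  also have "\<dots> \<le> n * n" using ij by (intro mult_le_mono1) simp
  finally have less: "i * n + j < n * n" .
  have "(i * n + j) div n = i" "(i * n + j) mod n = j" using ij by simp_all
  then have val: "arrs \<sigma> 1 (i * n + j) = of_bool (M i j)"
    using less unfolding arr nth_default_map_upt by simp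
  have le: "i \<le> B" "j \<le> B" "i * n \<le> B" "i * n + j \<le> B" using less ij assms(4,5) by linarith+
  have B: "Suc 0 \<le> B" "n \<le> B" "Suc n \<le> B" using assms(4) by linarith+
  show "eval \<sigma> (matrix_entry u v) = of_bool (M (eval \<sigma> u - 1) (eval \<sigma> v - (n + 1)))"
    using val assms(1) unfolding i_def j_def by (simp add: matrix_entry_def)
  show "fits B \<sigma> (matrix_entry u v)"
    using val assms(1-3) le B unfolding i_def j_def by (simp add: matrix_entry_def)
qed

lemma wp_graph_com:
  assumes N: "N = 2 * n + 2" and "regs \<sigma>\<^sub>0 0 = n" and B: "N * N + 10 \<le> B"
    and arr1: "arrs \<sigma>\<^sub>0 1 = nth_default 0 (concat (map (\<lambda>i. encode_vec n (M i)) [0..<n]))"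
    and arr4: "arrs \<sigma>\<^sub>0 4 = (\<lambda>_. 0)"
  shows "wp B \<omega> graph_com (\<lambda>t \<sigma>. t \<le> 200 * (N * N) + 200 \<and> regs \<sigma> 1 = n \<and>
      (\<forall>r\<ge>8. regs \<sigma> r = regs \<sigma>\<^sub>0 r) \<and> tape_pos \<sigma> = tape_pos \<sigma>\<^sub>0 \<and>
      arrs \<sigma> = (arrs \<sigma>\<^sub>0)(4 := nth_default 0 (encode_graph N (oumv_graph n M)))) \<sigma>\<^sub>0"
proof -
  define e where "e q = (of_bool ({q div N, q mod N} \<in> oumv_graph n M) :: nat)" for q
  define I where "I j \<sigma> \<longleftrightarrow> regs \<sigma> 1 = n \<and> regs \<sigma> 2 = N \<and> regs \<sigma> 3 = j \<and> regs \<sigma> 4 = N * N \<and>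
      (\<forall>r\<ge>8. regs \<sigma> r = regs \<sigma>\<^sub>0 r) \<and> tape_pos \<sigma> = tape_pos \<sigma>\<^sub>0 \<and>
      arrs \<sigma> = (arrs \<sigma>\<^sub>0)(4 := (\<lambda>q. if q < j then e q else 0))" for j and \<sigma> :: state
  have small: "N \<le> B" "n * n \<le> B" "N * N \<le> B" "1 \<le> B"
  proof -
    have "n * n \<le> N * N" "N * 1 \<le> N * N" using N by (intro mult_le_mono; simp)+
    then show "N \<le> B" "n * n \<le> B" "N * N \<le> B" "1 \<le> B" using B by linarith+
  qed
  \<comment> \<open>The constant 190 is a generous bound for one pass; with the 4 for the loop test
    this gives the 194 per cell below.\<close>
  have body: "wp B \<omega> graph_body (\<lambda>t \<sigma>'. t \<le> 190 \<and> I (Suc j) \<sigma>') \<sigma>" if j: "j < N * N" and I: "I j \<sigma>" for j \<sigma>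
  proof -
    let ?u = "Bin Div (Reg 3) (Reg 2)" and ?v = "Bin Mod (Reg 3) (Reg 2)"
    have jB: "j \<le> B" "Suc j \<le> B" using j small by linarith+
    have r1: "regs \<sigma> 1 = n" using I by (simp add: I_def)
    have uv: "fits B \<sigma> ?u" "fits B \<sigma> ?v" "eval \<sigma> ?u = j div N" "eval \<sigma> ?v = j mod N"
      using I jB small order_trans[OF div_le_dividend jB(1), of N]
        order_trans[OF mod_less_eq_dividend jB(1), of N] by (simp_all add: I_def)
    have a1: "arrs \<sigma> 1 = nth_default 0 (map (\<lambda>q. of_bool (M (q div n) (q mod n))) [0..<n * n])"
      using I arr1 by (simp add: I_def encode_matrix_eq)
    have upd: "(arrs \<sigma>)(4 := (arrs \<sigma> 4)(j := e j)) = (arrs \<sigma>\<^sub>0)(4 := (\<lambda>q. if q < Suc j then e q else 0))"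
      using I by (auto simp: I_def fun_eq_iff less_Suc_eq)
    have upd0: "arrs \<sigma> = (arrs \<sigma>\<^sub>0)(4 := (\<lambda>q. if q < Suc j then e q else 0))" if "e j = 0"
      using I that by (auto simp: I_def fun_eq_iff less_Suc_eq)
    note g1 = edge_guard[OF r1 uv(1,2) small(1)[unfolded N]] and g2 = edge_guard[OF r1 uv(2,1) small(1)[unfolded N]]
    note m1 = matrix_entry[OF r1 uv(1,2) small(1)[unfolded N] small(2) a1]
      and m2 = matrix_entry[OF r1 uv(2,1) small(1)[unfolded N] small(2) a1]
    consider (a) "eval \<sigma> (edge_guard ?u ?v) \<noteq> 0"
      | (b) "eval \<sigma> (edge_guard ?u ?v) = 0" "eval \<sigma> (edge_guard ?v ?u) \<noteq> 0"
      | (c) "eval \<sigma> (edge_guard ?u ?v) = 0" "eval \<sigma> (edge_guard ?v ?u) = 0" by blast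
    then show ?thesis
    proof cases
      case a
      then have rc: "0 < eval \<sigma> ?u" "eval \<sigma> ?u < n + 1" "n < eval \<sigma> ?v" "eval \<sigma> ?v < 2 * n + 1"
        unfolding g1(2) by simp_all
      have "eval \<sigma> (matrix_entry ?u ?v) = e j"
        unfolding m1(2)[OF rc] e_def mem_oumv_graph using rc unfolding uv(3,4) by simp
      then show ?thesis
        using a g1(1) m1(1)[OF rc] upd I jB small unfolding graph_body_def Let_def
        by (simp add: wp_simps I_def cost_edge_guard cost_matrix_entry)
    next
      case b
      then have rc: "0 < eval \<sigma> ?v" "eval \<sigma> ?v < n + 1" "n < eval \<sigma> ?u" "eval \<sigma> ?u < 2 * n + 1"
        unfolding g2(2) by simp_all
      have "eval \<sigma> (matrix_entry ?v ?u) = e j"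
        unfolding m2(2)[OF rc] e_def mem_oumv_graph using rc unfolding uv(3,4) by simp
      then show ?thesis
        using b g1(1) g2(1) m2(1)[OF rc] upd I jB small unfolding graph_body_def Let_def
        by (simp add: wp_simps I_def cost_edge_guard cost_matrix_entry)
    next
      case c
      then have "e j = 0" using g1(2) g2(2) unfolding e_def mem_oumv_graph uv(3,4) by auto
      then show ?thesis
        using c g1(1) g2(1) upd0 I jB small unfolding graph_body_def Let_def
        by (simp add: wp_simps I_def cost_edge_guard)
    qed
  qed
  let ?\<sigma> = "\<sigma>\<^sub>0\<lparr>regs := (regs \<sigma>\<^sub>0)(1 := n, 2 := N, 3 := 0, 4 := N * N)\<rparr>"
  have "I 0 ?\<sigma>" using arr4 by (auto simp: I_def)
  have counter: "regs \<sigma> 3 = j \<and> regs \<sigma> 4 = N * N" if "I j \<sigma>" for j \<sigma>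
    using that by (simp add: I_def)
  have "wp B \<omega> (Loop (Bin Less (Reg 3) (Reg 4)) graph_body)
     (\<lambda>t \<sigma>'. t \<le> (\<Sum>j<N * N. 190 + 4) + 4 \<and> I (N * N) \<sigma>') ?\<sigma>"
    by (rule wp_for_loop[where I = I and f = "\<lambda>_. 190", OF body counter small(3,4) \<open>I 0 ?\<sigma>\<close>])
  then have "wp B \<omega> (Loop (Bin Less (Reg 3) (Reg 4)) graph_body)
     (\<lambda>t \<sigma>. t \<le> 194 * (N * N) + 4 \<and> regs \<sigma> 1 = n \<and>
      (\<forall>r\<ge>8. regs \<sigma> r = regs \<sigma>\<^sub>0 r) \<and> tape_pos \<sigma> = tape_pos \<sigma>\<^sub>0 \<and>
      arrs \<sigma> = (arrs \<sigma>\<^sub>0)(4 := nth_default 0 (encode_graph N (oumv_graph n M)))) ?\<sigma>"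
    by (rule wp_mono) (simp add: I_def encode_graph_eq nth_default_map_upt e_def cong: if_cong)
  moreover have "Suc (Suc (2 * n)) = N" "n \<le> B" "2 * n \<le> B" "2 \<le> B" using N small(1) by linarith+
  ultimately show ?thesis
    unfolding graph_com_def wp_Seq wp_Assign using assms(2) small
    by simp (erule wp_mono, simp)
qed

section \<open>Writing the encoded predictions\<close>

definition emit :: "expr \<Rightarrow> com" where
  "emit e = Seq (Store 5 (Reg 5) e) (Assign 5 (Bin Add (Reg 5) (Lit 1)))"

definition emits :: "expr list \<Rightarrow> com" where
  "emits es = foldr (\<lambda>e. Seq (emit e)) es Skip"

text \<open>Within a block, an expression is evaluated after its predecessors have changed register
  5 and array 5; quantifying over \<open>a\<close> and \<open>b\<close> makes its value independent
  of them. The cost limit 5 is attained by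
  \<open>Bin Add (Bin Mod (Reg 3) (Reg 2)) (Lit 1)\<close>.\<close>

definition emits_value :: "nat \<Rightarrow> state \<Rightarrow> expr \<Rightarrow> nat \<Rightarrow> bool" where
  "emits_value B \<sigma> e v \<longleftrightarrow> cost e \<le> 5 \<and>
     (\<forall>a b. fits B (\<sigma>\<lparr>regs := (regs \<sigma>)(5 := a), arrs := (arrs \<sigma>)(5 := b)\<rparr>) e \<and>
            eval (\<sigma>\<lparr>regs := (regs \<sigma>)(5 := a), arrs := (arrs \<sigma>)(5 := b)\<rparr>) e = v)"

text \<open>Per word, the store costs at most \<open>1 + 5 + 1\<close> and the increment of register
  5 costs 4, together 11; the last 1 pays for the final \<open>Skip\<close>. The assumption on the
  lengths keeps the write position within a machine word.\<close>

lemma wp_emits: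
  assumes "arrs \<sigma> 5 = nth_default 0 xs" "regs \<sigma> 5 = length xs" "length xs + length es \<le> B"
    and "list_all2 (emits_value B \<sigma>) es vs"
  shows "wp B \<omega> (emits es) (\<lambda>t \<sigma>'. t \<le> 11 * length es + 1 \<and>
      \<sigma>' = \<sigma>\<lparr>regs := (regs \<sigma>)(5 := length (xs @ vs)), arrs := (arrs \<sigma>)(5 := nth_default 0 (xs @ vs))\<rparr>) \<sigma>"
  using assms
proof (induction es arbitrary: vs \<sigma> xs)
  case Nil
  have "(regs \<sigma>)(5 := length xs) = regs \<sigma>" "(arrs \<sigma>)(5 := nth_default 0 xs) = arrs \<sigma>"
    using Nil by (metis fun_upd_triv)+
  then show ?case using Nil.prems(4) by (simp add: emits_def wp_Skip)
next
  case (Cons e es vs')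
  from Cons.prems(4) obtain v vs where vs': "vs' = v # vs"
    and v: "emits_value B \<sigma> e v" and vs: "list_all2 (emits_value B \<sigma>) es vs"
    by (auto simp: list_all2_Cons1)
  let ?\<sigma> = "\<sigma>\<lparr>regs := (regs \<sigma>)(5 := length (xs @ [v])), arrs := (arrs \<sigma>)(5 := nth_default 0 (xs @ [v]))\<rparr>"
  have eq: "\<sigma>\<lparr>regs := (regs \<sigma>)(5 := length xs), arrs := (arrs \<sigma>)(5 := nth_default 0 xs)\<rparr> = \<sigma>"
    using Cons.prems fun_upd_triv[of "regs \<sigma>" 5] fun_upd_triv[of "arrs \<sigma>" 5] by simp
  note hyp = v[unfolded emits_value_def, THEN conjunct2, THEN spec, of "length xs", THEN spec, of "nth_default 0 xs"]
  have e: "fits B \<sigma> e" "eval \<sigma> e = v" "cost e \<le> 5"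
    using subst[where P = "\<lambda>\<sigma>. fits B \<sigma> e \<and> eval \<sigma> e = v", OF eq hyp] v unfolding emits_value_def by blast+
  have IH: "wp B \<omega> (emits es) (\<lambda>t \<sigma>'. t \<le> 11 * length es + 1 \<and>
      \<sigma>' = ?\<sigma>\<lparr>regs := (regs ?\<sigma>)(5 := length ((xs @ [v]) @ vs)),
        arrs := (arrs ?\<sigma>)(5 := nth_default 0 ((xs @ [v]) @ vs))\<rparr>) ?\<sigma>"
    by (rule Cons.IH) (use Cons.prems vs in \<open>auto simp: emits_value_def[abs_def]\<close>)
  have "wp B \<omega> (emit e) (\<lambda>t \<sigma>'. t \<le> 11 \<and> \<sigma>' = ?\<sigma>) \<sigma>"
    using e Cons.prems by (simp add: emit_def wp_simps nth_default_snoc)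
  then have "wp B \<omega> (emit e) (\<lambda>t. wp B \<omega> (emits es) (\<lambda>t' \<sigma>'. t + t' \<le> 11 * length (e # es) + 1 \<and>
      \<sigma>' = \<sigma>\<lparr>regs := (regs \<sigma>)(5 := length (xs @ v # vs)), arrs := (arrs \<sigma>)(5 := nth_default 0 (xs @ v # vs))\<rparr>)) \<sigma>"
  proof (rule wp_mono)
    fix t :: nat and \<sigma>' :: state assume t: "t \<le> 11 \<and> \<sigma>' = ?\<sigma>"
    show "wp B \<omega> (emits es) (\<lambda>t' \<sigma>'. t + t' \<le> 11 * length (e # es) + 1 \<and>
      \<sigma>' = \<sigma>\<lparr>regs := (regs \<sigma>)(5 := length (xs @ v # vs)), arrs := (arrs \<sigma>)(5 := nth_default 0 (xs @ v # vs))\<rparr>) \<sigma>'"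
      unfolding t[THEN conjunct2] by (rule wp_mono[OF IH]) (use t in simp)
  qed
  then show ?case by (simp add: emits_def wp_Seq vs' fun_upd_def)
qed

text \<open>Register 2 holds \<open>2 * n + 1\<close>, which is both the number of positions in a
  round and the number of the dummy vertex.\<close>

definition predictions_body :: com where
  "predictions_body =
     Seq (Cond (Bin Less (Bin Mod (Reg 3) (Reg 2)) (Bin Mul (Lit 2) (Reg 1)))
            (emits [Lit 2, Lit 1, Lit 0, Bin Add (Bin Mod (Reg 3) (Reg 2)) (Lit 1), Lit 1, Lit 0, Reg 2])
            (emits [Lit 1, Lit 0, Lit 0, Lit 0]))
         (Assign 3 (Bin Add (Reg 3) (Lit 1)))"

definition predictions_com :: com where
  "predictions_com =
     Seq (Assign 2 (Bin Add (Bin Mul (Lit 2) (Reg 1)) (Lit 1)))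
    (Seq (Assign 3 (Lit 0))
    (Seq (Assign 4 (Bin Mul (Reg 1) (Reg 2)))
    (Seq (Assign 5 (Lit 0))
         (Loop (Bin Less (Reg 3) (Reg 4)) predictions_body))))"

lemma encode_predictions_snoc:
  "encode_predictions (ps @ [p]) = encode_predictions ps @ length p # concat (map encode_request p)"
  by (simp add: encode_predictions_def)

lemma encode_oumv_predict:
  "length (oumv_predict n p) # concat (map encode_request (oumv_predict n p)) =
     (if p mod (2 * n + 1) < 2 * n
      then [2, 1, 0, p mod (2 * n + 1) + 1, 1, 0, 2 * n + 1] else [1, 0, 0, 0])"
  by (simp add: oumv_predict_def Let_def)

text \<open>The longest block is a length followed by two requests of three words each. This bounds
  the write position and explains the factor 7 in the word bound.\<close>

lemma length_encode_oumv_predictions: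
  "length (encode_predictions (map (oumv_predict n) [0..<j])) \<le> 7 * j"
proof (induction j)
  case (Suc j)
  have "length (length (oumv_predict n j) # concat (map encode_request (oumv_predict n j))) \<le> 7"
    unfolding encode_oumv_predict by simp
  with Suc show ?case by (simp add: encode_predictions_snoc)
qed (simp add: encode_predictions_def)

text \<open>The final value of register 4 is recorded because \<open>n * m\<close> is the number of
  predicted sets, which is copied into the guest's input afterwards.\<close>

lemma wp_predictions_com:
  assumes m: "m = 2 * n + 1" and "regs \<sigma>\<^sub>0 1 = n" and B: "7 * (n * m) + m + 10 \<le> B"
    and arr5: "arrs \<sigma>\<^sub>0 5 = (\<lambda>_. 0)"
  shows "wp B \<omega> predictions_com (\<lambda>t \<sigma>. t \<le> 200 * (n * m) + 200 \<and> regs \<sigma> 1 = n \<and> regs \<sigma> 4 = n * m \<and>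
      (\<forall>r\<ge>8. regs \<sigma> r = regs \<sigma>\<^sub>0 r) \<and> tape_pos \<sigma> = tape_pos \<sigma>\<^sub>0 \<and>
      arrs \<sigma> = (arrs \<sigma>\<^sub>0)(5 := nth_default 0 (encode_predictions (oumv_predictions n)))) \<sigma>\<^sub>0"
proof -
  define E where "E j = encode_predictions (map (oumv_predict n) [0..<j])" for j
  define I where "I j \<sigma> \<longleftrightarrow> regs \<sigma> 1 = n \<and> regs \<sigma> 2 = m \<and> regs \<sigma> 3 = j \<and> regs \<sigma> 4 = n * m \<and>
      regs \<sigma> 5 = length (E j) \<and>
      (\<forall>r\<ge>8. regs \<sigma> r = regs \<sigma>\<^sub>0 r) \<and> tape_pos \<sigma> = tape_pos \<sigma>\<^sub>0 \<and>
      arrs \<sigma> = (arrs \<sigma>\<^sub>0)(5 := nth_default 0 (E j))" for j and \<sigma> :: state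
  have small: "n * m \<le> B" "1 \<le> B" "m \<le> B" "10 \<le> B" "2 * n \<le> B" using B m by linarith+
  have E_Suc: "E (Suc j) = E j @ (if j mod m < 2 * n then [2, 1, 0, j mod m + 1, 1, 0, m] else [1, 0, 0, 0])" for j
    unfolding E_def m encode_oumv_predict[symmetric] by (simp add: encode_predictions_snoc)
  have body: "wp B \<omega> predictions_body (\<lambda>t \<sigma>'. t \<le> 190 \<and> I (Suc j) \<sigma>') \<sigma>"
    if j: "j < n * m" and I: "I j \<sigma>" for j \<sigma>
  proof -
    have len: "length (E j) + 7 \<le> B" "Suc j \<le> B" "j \<le> B"
      using length_encode_oumv_predictions[of n j] j B unfolding E_def by linarith+
    have jm: "j mod m < m" "Suc (j mod m) \<le> B" using m small(3) mod_less_divisor[of m j] by linarith+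
    note * = I[unfolded I_def]
    have a5: "arrs \<sigma> 5 = nth_default 0 (E j)" "regs \<sigma> 5 = length (E j)" using * by simp_all
    let ?g = "Bin Less (Bin Mod (Reg 3) (Reg 2)) (Bin Mul (Lit 2) (Reg 1))"
    have g: "fits B \<sigma> ?g" "eval \<sigma> ?g \<noteq> 0 \<longleftrightarrow> j mod m < 2 * n" "cost ?g = 7"
      using * len jm small by auto
    show ?thesis
    proof (cases "j mod m < 2 * n")
      case True
      have "wp B \<omega> (emits [Lit 2, Lit 1, Lit 0, Bin Add (Bin Mod (Reg 3) (Reg 2)) (Lit 1), Lit 1, Lit 0, Reg 2])
        (\<lambda>t \<sigma>'. t \<le> 100 \<and> \<sigma>' = \<sigma>\<lparr>regs := (regs \<sigma>)(5 := length (E (Suc j))),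
          arrs := (arrs \<sigma>)(5 := nth_default 0 (E (Suc j)))\<rparr>) \<sigma>"
        unfolding E_Suc if_P[OF True]
        by (rule wp_mono[OF wp_emits[OF a5, where vs = "[2, 1, 0, j mod m + 1, 1, 0, m]"]])
          (use * len jm small in \<open>auto simp: emits_value_def\<close>)
      then show ?thesis
        unfolding predictions_body_def wp_Seq wp_Cond using g True
        by simp (erule wp_mono, use * len in \<open>simp add: wp_simps I_def\<close>)
    next
      case False
      have "wp B \<omega> (emits [Lit 1, Lit 0, Lit 0, Lit 0])
        (\<lambda>t \<sigma>'. t \<le> 100 \<and> \<sigma>' = \<sigma>\<lparr>regs := (regs \<sigma>)(5 := length (E (Suc j))),
          arrs := (arrs \<sigma>)(5 := nth_default 0 (E (Suc j)))\<rparr>) \<sigma>"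
        unfolding E_Suc if_not_P[OF False]
        by (rule wp_mono[OF wp_emits[OF a5, where vs = "[1, 0, 0, 0]"]])
          (use * len jm small in \<open>auto simp: emits_value_def\<close>)
      then show ?thesis
        unfolding predictions_body_def wp_Seq wp_Cond using g False
        by simp (erule wp_mono, use * len in \<open>simp add: wp_simps I_def\<close>)
    qed
  qed
  let ?\<sigma> = "\<sigma>\<^sub>0\<lparr>regs := (regs \<sigma>\<^sub>0)(2 := m, 3 := 0, 4 := n * m, 5 := 0)\<rparr>"
  have "(arrs \<sigma>\<^sub>0)(5 := nth_default 0 (E 0)) = arrs \<sigma>\<^sub>0"
    using arr5 by (auto simp: E_def encode_predictions_def nth_default_def fun_eq_iff)
  then have "I 0 ?\<sigma>" using assms(2) by (simp add: I_def E_def encode_predictions_def)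
  have counter: "regs \<sigma> 3 = j \<and> regs \<sigma> 4 = n * m" if "I j \<sigma>" for j \<sigma>
    using that by (simp add: I_def)
  have "wp B \<omega> (Loop (Bin Less (Reg 3) (Reg 4)) predictions_body)
     (\<lambda>t \<sigma>'. t \<le> (\<Sum>j<n * m. 190 + 4) + 4 \<and> I (n * m) \<sigma>') ?\<sigma>"
    by (rule wp_for_loop[where I = I and f = "\<lambda>_. 190", OF body counter small(1,2) \<open>I 0 ?\<sigma>\<close>])
  moreover have "E (n * m) = encode_predictions (oumv_predictions n)"
    by (simp add: E_def oumv_predictions_def m)
  ultimately have "wp B \<omega> (Loop (Bin Less (Reg 3) (Reg 4)) predictions_body)
     (\<lambda>t \<sigma>. t \<le> 194 * (n * m) + 4 \<and> regs \<sigma> 1 = n \<and> regs \<sigma> 4 = n * m \<and>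
      (\<forall>r\<ge>8. regs \<sigma> r = regs \<sigma>\<^sub>0 r) \<and> tape_pos \<sigma> = tape_pos \<sigma>\<^sub>0 \<and>
      arrs \<sigma> = (arrs \<sigma>\<^sub>0)(5 := nth_default 0 (encode_predictions (oumv_predictions n)))) ?\<sigma>"
    by (elim wp_mono) (simp add: I_def)
  moreover have "Suc (2 * n) = m" "n \<le> B" "2 \<le> B" using m small by linarith+
  ultimately show ?thesis
    unfolding predictions_com_def wp_Seq wp_Assign using assms(2) small
    by simp (erule wp_mono, simp)
qed

section \<open>The complete host programs\<close>

definition send :: "expr \<Rightarrow> expr \<Rightarrow> expr \<Rightarrow> com" where
  "send x y z = Seq (Store 3 (Lit 0) x) (Seq (Store 3 (Lit 1) y) (Store 3 (Lit 2) z))"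

text \<open>A flip is sent as 1, minimum, maximum, and the minimum is always vertex 0. Array 2 is
  overwritten one coordinate at a time, so after the loop it already holds the previous pair for the
  next round.\<close>

definition respond_body :: "com \<Rightarrow> com" where
  "respond_body c =
     Seq (Cond (Bin Equal (Arr 0 (Reg 3)) (Arr 2 (Reg 3)))
           (send (Lit 1) (Lit 0) (Bin Add (Bin Mul (Lit 2) (Reg 1)) (Lit 1)))
           (send (Lit 1) (Lit 0) (Bin Add (Reg 3) (Lit 1))))
    (Seq (Store 2 (Reg 3) (Arr 0 (Reg 3)))
    (Seq (shift_com c)
         (Assign 3 (Bin Add (Reg 3) (Lit 1)))))"

definition respond_com :: "com \<Rightarrow> com" where
  "respond_com c =
     Seq (Assign 3 (Lit 0))
    (Seq (Assign 4 (Bin Mul (Lit 2) (Reg 1)))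
    (Seq (Loop (Bin Less (Reg 3) (Reg 4)) (respond_body c))
    (Seq (send (Lit 0) (Lit 0) (Lit 0))
    (Seq (shift_com c)
         (Assign 0 (Bin Less (Lit 0) (Reg 8)))))))"

text \<open>Registers 8, 9, 10 are the guest's registers 0, 1, 2. Register 9 keeps its initial value
  0, which is the vertex \<open>s\<close>.\<close>

definition preprocess_com :: "com \<Rightarrow> com" where
  "preprocess_com c =
     Seq graph_com
    (Seq predictions_com
    (Seq (Assign 8 (Bin Add (Bin Mul (Lit 2) (Reg 1)) (Lit 2)))
    (Seq (Assign 10 (Reg 4))
         (shift_com c))))"

definition oumv_alg :: "online_alg \<Rightarrow> online_alg" where
  "oumv_alg A = \<lparr>preprocess = preprocess_com (preprocess A), respond = respond_com (respond A)\<rparr>"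

lemma guest_send:
  "guest (\<sigma>\<lparr>arrs := (arrs \<sigma>)(3 := (arrs \<sigma> 3)(0 := x, 1 := y, 2 := z))\<rparr>) =
     put_request [x, y, z] (guest \<sigma>)"
  by (auto simp: guest_def put_request_def fun_eq_iff nth_Cons' less_Suc_eq numeral_3_eq_3)

lemma guest_host_array: "a < 3 \<Longrightarrow> guest (\<sigma>\<lparr>arrs := (arrs \<sigma>')(a := f)\<rparr>) = guest (\<sigma>\<lparr>arrs := arrs \<sigma>'\<rparr>)"
  by (auto simp: guest_def fun_eq_iff)

lemma guest_host_reg: "r < 8 \<Longrightarrow> guest (\<sigma>\<lparr>regs := (regs \<sigma>)(r := x)\<rparr>) = guest \<sigma>"
  by (auto simp: guest_def fun_eq_iff)

lemma encode_pair_nth: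
  "length (encode_pair n uv) = 2 * n"
  "k < 2 * n \<Longrightarrow> encode_pair n uv ! k = of_bool (coord n uv k)"
  by (auto simp: encode_pair_def encode_vec_def coord_def nth_append)

text \<open>After the two assignments the guest's memory is exactly the input state of the triangle
  problem, so the given run of \<open>c\<close> can be replayed. Array 2 is still zero and thus
  encodes the zero vectors before the first round.\<close>

lemma wp_preprocess_com:
  assumes B: "40 * (n + 1) ^ 2 \<le> B'" "B \<le> B'"
    and run: "exec B \<omega> c (striangle_input (2 * n + 2) 0 (oumv_graph n M) (oumv_predictions n)) t\<^sub>0 \<tau>"
  shows "wp B' \<omega> (preprocess_com c)
     (\<lambda>t \<sigma>. t \<le> t\<^sub>0 + 2000 * (n + 1) ^ 2 \<and> regs \<sigma> 1 = n \<and> arrs \<sigma> 2 = (\<lambda>_. 0) \<and>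
        guest \<sigma> = \<tau> \<and> (\<forall>r. regs \<tau> r \<le> B')) (oumv_input n M)"
proof -
  define N m where "N = 2 * n + 2" and "m = 2 * n + 1"
  let ?G = "nth_default 0 (encode_graph N (oumv_graph n M))"
  let ?E = "nth_default 0 (encode_predictions (oumv_predictions n))"
  let ?\<tau>0 = "striangle_input N 0 (oumv_graph n M) (oumv_predictions n)"
  define \<sigma>\<^sub>0 where "\<sigma>\<^sub>0 = oumv_input n M"
  \<comment> \<open>The term \<open>40 * (n + 1) ^ 2\<close> covers the cells of the adjacency
    matrix as well as the at most seven words per prediction.\<close>
  have bounds: "N * N + 10 \<le> B'" "7 * (n * m) + m + 10 \<le> B'" "N \<le> B'" "n * m \<le> B'" "1 \<le> B'" "2 \<le> B'" "2 * n \<le> B'" "n \<le> B'"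
    using B(1) unfolding N_def m_def by (simp_all add: power2_eq_square algebra_simps)
  have time: "200 * (N * N) + 200 + (200 * (n * m) + 200) + 100 \<le> 2000 * (n + 1) ^ 2"
    unfolding N_def m_def by (simp add: power2_eq_square algebra_simps)
  have 0: "regs \<sigma>\<^sub>0 0 = n" "regs \<sigma>\<^sub>0 r = 0" "arrs \<sigma>\<^sub>0 a = (\<lambda>_. 0)" "tape_pos \<sigma>\<^sub>0 = 0"
    "arrs \<sigma>\<^sub>0 1 = nth_default 0 (concat (map (\<lambda>i. encode_vec n (M i)) [0..<n]))"
    if "r > 0" "a \<noteq> 1" for r a
    using that by (auto simp: \<sigma>\<^sub>0_def oumv_input_def init_state_def nth_default_def nth_Cons' fun_eq_iff)
  have 1: "wp B' \<omega> graph_com (\<lambda>t \<sigma>. t \<le> 200 * (N * N) + 200 \<and> regs \<sigma> 1 = n \<and>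
      (\<forall>r\<ge>8. regs \<sigma> r = regs \<sigma>\<^sub>0 r) \<and> tape_pos \<sigma> = tape_pos \<sigma>\<^sub>0 \<and> arrs \<sigma> = (arrs \<sigma>\<^sub>0)(4 := ?G)) \<sigma>\<^sub>0"
    by (rule wp_graph_com[OF N_def]) (use 0[of 1 4] bounds in auto)
  have 2: "wp B' \<omega> predictions_com (\<lambda>t \<sigma>'. t \<le> 200 * (n * m) + 200 \<and> regs \<sigma>' 1 = n \<and> regs \<sigma>' 4 = n * m \<and>
      (\<forall>r\<ge>8. regs \<sigma>' r = regs \<sigma> r) \<and> tape_pos \<sigma>' = tape_pos \<sigma> \<and>
      arrs \<sigma>' = (arrs \<sigma>)(5 := ?E)) \<sigma>"
    if "regs \<sigma> 1 = n" "arrs \<sigma> = (arrs \<sigma>\<^sub>0)(4 := ?G)" for \<sigma>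
    by (rule wp_predictions_com[OF m_def]) (use that 0[of 1 5] bounds in auto)
  have regs: "\<forall>r. regs \<tau> r \<le> B'"
  proof (rule exec_regs_le[OF run B(2) bounds(5)], rule allI)
    fix r
    show "regs (striangle_input (2 * n + 2) 0 (oumv_graph n M) (oumv_predictions n)) r \<le> B'"
      using bounds(3,4) by (auto simp: striangle_input_def init_state_def nth_default_def nth_Cons'
          length_oumv_predictions N_def m_def)
  qed
  have 3: "wp B' \<omega> (Seq (Assign 8 (Bin Add (Bin Mul (Lit 2) (Reg 1)) (Lit 2)))
      (Seq (Assign 10 (Reg 4)) (shift_com c)))
     (\<lambda>t \<sigma>'. t \<le> t\<^sub>0 + 100 \<and> regs \<sigma>' 1 = n \<and> arrs \<sigma>' 2 = (\<lambda>_. 0) \<and> guest \<sigma>' = \<tau>) \<sigma>"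
    if s: "regs \<sigma> 1 = n" "regs \<sigma> 4 = n * m" "\<forall>r\<ge>8. regs \<sigma> r = regs \<sigma>\<^sub>0 r" "tape_pos \<sigma> = tape_pos \<sigma>\<^sub>0"
      "arrs \<sigma> = (arrs \<sigma>\<^sub>0)(4 := ?G, 5 := ?E)" for \<sigma>
  proof -
    let ?\<sigma> = "\<sigma>\<lparr>regs := (regs \<sigma>)(8 := N, 10 := n * m)\<rparr>"
    have "regs (guest ?\<sigma>) r = regs ?\<tau>0 r" for r
      using s(3) 0(2)[of "r + 8" 0]
      by (auto simp: guest_def striangle_input_def init_state_def nth_default_def nth_Cons'
          length_oumv_predictions m_def numeral_2_eq_2)
    moreover have "arrs (guest ?\<sigma>) a = arrs ?\<tau>0 a" for a
    proof -
      consider "a = 0" | "a = 1" | "a = 2" | "a \<ge> 3" by linarith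
      then show ?thesis
        using 0(3)[of 1 "a + 3"]
        by cases (auto simp: guest_def s(5) striangle_input_def init_state_def nth_default_def fun_eq_iff)
    qed
    moreover have "tape_pos (guest ?\<sigma>) = tape_pos ?\<tau>0"
      using s(4) 0(4)[of 1 0] by (simp add: guest_def striangle_input_def init_state_def)
    ultimately have "guest ?\<sigma> = ?\<tau>0" by (intro state.equality ext) auto
    then have "exec B \<omega> c (guest ?\<sigma>) t\<^sub>0 \<tau>" using run by (simp add: N_def)
    then have "wp B' \<omega> (shift_com c)
        (\<lambda>t \<sigma>'. t \<le> t\<^sub>0 \<and> regs \<sigma>' 1 = n \<and> arrs \<sigma>' 2 = (\<lambda>_. 0) \<and> guest \<sigma>' = \<tau>) ?\<sigma>"
      by (rule wp_shift[OF _ B(2)]) (use s 0[of 1 2] in \<open>auto simp: same_host_def\<close>)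
    moreover have "Suc (Suc (2 * n)) = N" by (simp add: N_def)
    ultimately show ?thesis
      using s(1,2) bounds unfolding wp_Seq wp_Assign by simp (erule wp_mono, simp)
  qed
  show ?thesis
    unfolding preprocess_com_def wp_Seq[of _ _ graph_com] wp_Seq[of _ _ predictions_com] \<sigma>\<^sub>0_def[symmetric]
  proof (rule wp_mono[OF 1], elim conjE)
    fix t and \<sigma> :: state
    assume a: "t \<le> 200 * (N * N) + 200" "regs \<sigma> 1 = n" "\<forall>r\<ge>8. regs \<sigma> r = regs \<sigma>\<^sub>0 r"
      "tape_pos \<sigma> = tape_pos \<sigma>\<^sub>0" "arrs \<sigma> = (arrs \<sigma>\<^sub>0)(4 := ?G)"
    show "wp B' \<omega> predictions_com (\<lambda>t'. wp B' \<omega> (Seq (Assign 8 (Bin Add (Bin Mul (Lit 2) (Reg 1)) (Lit 2)))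
        (Seq (Assign 10 (Reg 4)) (shift_com c)))
      (\<lambda>t'' \<sigma>. t + (t' + t'') \<le> t\<^sub>0 + 2000 * (n + 1) ^ 2 \<and> regs \<sigma> 1 = n \<and> arrs \<sigma> 2 = (\<lambda>_. 0) \<and>
        guest \<sigma> = \<tau> \<and> (\<forall>r. regs \<tau> r \<le> B'))) \<sigma>"
    proof (rule wp_mono[OF 2[OF a(2,5)]], elim conjE)
      fix t' and \<sigma>' :: state
      assume b: "t' \<le> 200 * (n * m) + 200" "regs \<sigma>' 1 = n" "regs \<sigma>' 4 = n * m"
        "\<forall>r\<ge>8. regs \<sigma>' r = regs \<sigma> r" "tape_pos \<sigma>' = tape_pos \<sigma>" "arrs \<sigma>' = (arrs \<sigma>)(5 := ?E)"
      have c: "\<forall>r\<ge>8. regs \<sigma>' r = regs \<sigma>\<^sub>0 r" "tape_pos \<sigma>' = tape_pos \<sigma>\<^sub>0"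
        "arrs \<sigma>' = (arrs \<sigma>\<^sub>0)(4 := ?G, 5 := ?E)" using a b by auto
      have le: "t + (t' + s) \<le> t\<^sub>0 + 2000 * (n + 1) ^ 2" if "s \<le> t\<^sub>0 + 100" for s
        using that a(1) b(1) time by linarith
      show "wp B' \<omega> (Seq (Assign 8 (Bin Add (Bin Mul (Lit 2) (Reg 1)) (Lit 2)))
        (Seq (Assign 10 (Reg 4)) (shift_com c)))
      (\<lambda>t'' \<sigma>. t + (t' + t'') \<le> t\<^sub>0 + 2000 * (n + 1) ^ 2 \<and> regs \<sigma> 1 = n \<and> arrs \<sigma> 2 = (\<lambda>_. 0) \<and>
        guest \<sigma> = \<tau> \<and> (\<forall>r. regs \<tau> r \<le> B')) \<sigma>'"
        by (rule wp_mono[OF 3[OF b(2,3) c]]) (use regs le in blast)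
    qed
  qed
qed

lemma encode_oumv_requests_nth:
  assumes "t < n" "k \<le> 2 * n"
  shows "map encode_request (oumv_requests n uvs) ! (t * (2 * n + 1) + k) =
    (if k < 2 * n
     then [1, 0, if coord n (uvs ! t) k \<noteq> prev_coord n uvs t k then k + 1 else 2 * n + 1]
     else [0, 0, 0])"
proof -
  have "map encode_request (oumv_requests n uvs) ! (t * (2 * n + 1) + k) =
      encode_request (oumv_requests n uvs ! (t * (2 * n + 1) + k))"
    using position_less[OF assms] by (simp only: nth_map length_oumv_requests)
  then show ?thesis unfolding oumv_requests_nth[OF assms] by simp
qed

text \<open>The guest's transcript \<open>out\<close> is fixed beforehand and the state carries its
  remaining suffix. The bound on the guest's registers is there for the host's final read of the
  answer.\<close>

definition round_inv ::
  "nat \<Rightarrow> nat \<Rightarrow> (nat \<Rightarrow> bool) \<Rightarrow> com \<Rightarrow> nat \<Rightarrow> ((nat \<Rightarrow> bool) \<times> (nat \<Rightarrow> bool)) list \<Rightarrow> (nat \<times> nat) list \<Rightarrow>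
   nat \<Rightarrow> state \<Rightarrow> bool" where
  "round_inv B' B \<omega> c n uvs out t \<sigma> \<longleftrightarrow> regs \<sigma> 1 = n \<and>
     (\<forall>i<2 * n. arrs \<sigma> 2 i = of_bool (prev_coord n uvs t i)) \<and>
     (\<forall>r. regs (guest \<sigma>) r \<le> B') \<and>
     serve B \<omega> c (guest \<sigma>) (drop (t * (2 * n + 1)) (map encode_request (oumv_requests n uvs)))
       (drop (t * (2 * n + 1)) out)"

lemma put_request_regs: "regs (put_request ws \<sigma>) = regs \<sigma>"
  by (simp add: put_request_def)

lemma wp_respond_com:
  assumes B: "40 * (n + 1) ^ 2 \<le> B'" "B \<le> B'" and t: "t < n"
    and inv: "round_inv B' B \<omega> c n uvs out t \<sigma>\<^sub>0"
  shows "wp B' \<omega> (respond_com c)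
     (\<lambda>k \<sigma>. k \<le> (\<Sum>j<2 * n. fst (out ! (t * (2 * n + 1) + j))) + fst (out ! (t * (2 * n + 1) + 2 * n))
               + 300 * (n + 1) \<and>
            regs \<sigma> 0 = of_bool (snd (out ! (t * (2 * n + 1) + 2 * n)) > 0) \<and>
            round_inv B' B \<omega> c n uvs out (Suc t) \<sigma>)
     (put_request (encode_pair n (uvs ! t)) \<sigma>\<^sub>0)"
proof -
  define p where "p k = t * (2 * n + 1) + k" for k
  define wss where "wss = map encode_request (oumv_requests n uvs)"
  define x where "x k = (if coord n (uvs ! t) k \<noteq> prev_coord n uvs t k then k + 1 else 2 * n + 1)" for k
  have wss_nth: "wss ! p k = (if k < 2 * n then [1, 0, x k] else [0, 0, 0])" if "k \<le> 2 * n" for k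
    unfolding wss_def p_def x_def by (rule encode_oumv_requests_nth[OF t that])
  have p_less: "p k < length wss" if "k \<le> 2 * n" for k
    using position_less[OF t that] by (simp add: p_def wss_def length_oumv_requests)
  have p_Suc: "Suc (p k) = p (Suc k)" for k by (simp add: p_def)
  \<comment> \<open>The current pair stays readable in array 0 throughout the loop, because requests
    to the guest go to array 3.\<close>
  define I where "I k \<sigma> \<longleftrightarrow> regs \<sigma> 1 = n \<and> regs \<sigma> 3 = k \<and> regs \<sigma> 4 = 2 * n \<and>
     (\<forall>i<2 * n. arrs \<sigma> 0 i = of_bool (coord n (uvs ! t) i)) \<and>
     (\<forall>i<2 * n. arrs \<sigma> 2 i = of_bool (if i < k then coord n (uvs ! t) i else prev_coord n uvs t i)) \<and>
     (\<forall>r. regs (guest \<sigma>) r \<le> B') \<and>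
     serve B \<omega> c (guest \<sigma>) (drop (p k) wss) (drop (p k) out)" for k \<sigma>
  have bounds: "2 * n + 1 \<le> B'" "1 \<le> B'" "2 \<le> B'" "2 * n \<le> B'" "n \<le> B'"
    using B(1) by (simp_all add: power2_eq_square algebra_simps)
  have body: "wp B' \<omega> (respond_body c) (\<lambda>s \<sigma>'. s \<le> fst (out ! p k) + 100 \<and> I (Suc k) \<sigma>') \<sigma>"
    if k: "k < 2 * n" and I: "I k \<sigma>" for k \<sigma>
  proof -
    note * = I[unfolded I_def]
    have kB: "k \<le> B'" "Suc k \<le> B'" using k bounds by linarith+
    have a: "arrs \<sigma> 0 k = of_bool (coord n (uvs ! t) k)" "arrs \<sigma> 2 k = of_bool (prev_coord n uvs t k)"
      using * k by simp_all
    obtain \<tau> where \<tau>: "exec B \<omega> c (put_request (wss ! p k) (guest \<sigma>)) (fst (out ! p k)) \<tau>"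
      "serve B \<omega> c \<tau> (drop (p (Suc k)) wss) (drop (p (Suc k)) out)"
      by (rule serve_drop[of B \<omega> c "guest \<sigma>" "p k" wss out, unfolded p_Suc])
        (use * p_less[of k] k in auto)
    have regs_\<tau>: "\<forall>r. regs \<tau> r \<le> B'"
      by (rule exec_regs_le[OF \<tau>(1) B(2) bounds(2)]) (use * in \<open>simp add: put_request_regs\<close>)
    let ?\<sigma>1 = "\<sigma>\<lparr>arrs := (arrs \<sigma>)(3 := (arrs \<sigma> 3)(0 := 1, 1 := 0, 2 := x k))\<rparr>"
    let ?\<sigma>2 = "\<sigma>\<lparr>arrs := (arrs ?\<sigma>1)(2 := (arrs \<sigma> 2)(k := of_bool (coord n (uvs ! t) k)))\<rparr>"
    have send: "wp B' \<omega> (Cond (Bin Equal (Arr 0 (Reg 3)) (Arr 2 (Reg 3)))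
           (send (Lit 1) (Lit 0) (Bin Add (Bin Mul (Lit 2) (Reg 1)) (Lit 1)))
           (send (Lit 1) (Lit 0) (Bin Add (Reg 3) (Lit 1)))) (\<lambda>s \<sigma>'. s \<le> 50 \<and> \<sigma>' = ?\<sigma>1) \<sigma>"
      using * a kB bounds unfolding send_def x_def by (simp add: wp_simps)
    \<comment> \<open>The update of array 2 lies outside the guest's memory, so the guest sees only
      the three words of the request.\<close>
    have "guest ?\<sigma>2 = put_request (wss ! p k) (guest \<sigma>)"
      using wss_nth[of k] k guest_host_array[where a = 2 and \<sigma> = \<sigma> and \<sigma>' = ?\<sigma>1] guest_send[of \<sigma> 1 0 "x k"] by simp
    then have "wp B' \<omega> (shift_com c) (\<lambda>s \<sigma>'. s = fst (out ! p k) \<and> guest \<sigma>' = \<tau> \<and> same_host ?\<sigma>2 \<sigma>') ?\<sigma>2"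
      using \<tau>(1) by (intro wp_shift[OF _ B(2)]) auto
    then have run: "wp B' \<omega> (Seq (shift_com c) (Assign 3 (Bin Add (Reg 3) (Lit 1))))
        (\<lambda>s \<sigma>'. s \<le> fst (out ! p k) + 10 \<and> I (Suc k) \<sigma>') ?\<sigma>2"
      unfolding wp_Seq
    proof (rule wp_mono, elim conjE)
      fix s \<sigma>' assume \<sigma>': "s = fst (out ! p k)" "guest \<sigma>' = \<tau>" "same_host ?\<sigma>2 \<sigma>'"
      then have "regs \<sigma>' 1 = n" "regs \<sigma>' 3 = k" "regs \<sigma>' 4 = 2 * n" "arrs \<sigma>' 0 = arrs \<sigma> 0"
        "arrs \<sigma>' 2 = (arrs \<sigma> 2)(k := of_bool (coord n (uvs ! t) k))"
        using * by (simp_all add: same_host_def)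
      then have "I (Suc k) (\<sigma>'\<lparr>regs := (regs \<sigma>')(3 := Suc k)\<rparr>)"
        using * \<sigma>'(2) \<tau>(2) regs_\<tau> unfolding I_def by (auto simp: guest_host_reg less_Suc_eq)
      then show "wp B' \<omega> (Assign 3 (Bin Add (Reg 3) (Lit 1)))
          (\<lambda>t' \<sigma>'. s + t' \<le> fst (out ! p k) + 10 \<and> I (Suc k) \<sigma>') \<sigma>'"
        using \<open>regs \<sigma>' 3 = k\<close> \<sigma>'(1) kB bounds by (simp add: wp_simps)
    qed
    show ?thesis
      unfolding respond_body_def wp_Seq[of _ _ "Cond _ _ _"]
    proof (rule wp_mono[OF send], elim conjE)
      fix s :: nat and \<sigma>' :: state assume \<sigma>': "s \<le> 50" "\<sigma>' = ?\<sigma>1"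
      show "wp B' \<omega> (Seq (Store 2 (Reg 3) (Arr 0 (Reg 3))) (Seq (shift_com c) (Assign 3 (Bin Add (Reg 3) (Lit 1)))))
        (\<lambda>t' \<sigma>'. s + t' \<le> fst (out ! p k) + 100 \<and> I (Suc k) \<sigma>') \<sigma>'"
        unfolding wp_Seq[of _ _ "Store _ _ _"] wp_Store \<sigma>'(2)
        using wp_mono[OF run, of "\<lambda>t' \<sigma>'. s + (4 + t') \<le> fst (out ! p k) + 100 \<and> I (Suc k) \<sigma>'"] \<sigma>'(1) * a kB bounds
        by simp
    qed
  qed
  let ?\<sigma> = "put_request (encode_pair n (uvs ! t)) \<sigma>\<^sub>0"
  let ?\<sigma>' = "?\<sigma>\<lparr>regs := (regs ?\<sigma>)(3 := 0, 4 := 2 * n)\<rparr>"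
  note inv' = inv[unfolded round_inv_def]
  have "guest ?\<sigma>' = guest \<sigma>\<^sub>0"
    by (auto simp: guest_def put_request_def fun_eq_iff)
  then have start: "I 0 ?\<sigma>'"
    using inv' unfolding I_def
    by (auto simp: put_request_def encode_pair_nth p_def wss_def)
  have counter: "regs \<sigma> 3 = k \<and> regs \<sigma> 4 = 2 * n" if "I k \<sigma>" for k \<sigma>
    using that by (simp add: I_def)
  have loop: "wp B' \<omega> (Loop (Bin Less (Reg 3) (Reg 4)) (respond_body c))
     (\<lambda>s \<sigma>'. s \<le> (\<Sum>k<2 * n. fst (out ! p k) + 100 + 4) + 4 \<and> I (2 * n) \<sigma>') ?\<sigma>'"
    by (rule wp_for_loop[where I = I and f = "\<lambda>k. fst (out ! p k) + 100", OF body counter bounds(4,2) start])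
  have tail: "wp B' \<omega> (Seq (send (Lit 0) (Lit 0) (Lit 0)) (Seq (shift_com c) (Assign 0 (Bin Less (Lit 0) (Reg 8)))))
      (\<lambda>s \<sigma>. s \<le> fst (out ! p (2 * n)) + 50 \<and> regs \<sigma> 0 = of_bool (snd (out ! p (2 * n)) > 0) \<and>
         round_inv B' B \<omega> c n uvs out (Suc t) \<sigma>) \<sigma>" if I: "I (2 * n) \<sigma>" for \<sigma>
  proof -
    note * = I[unfolded I_def]
    obtain \<tau> where \<tau>: "exec B \<omega> c (put_request (wss ! p (2 * n)) (guest \<sigma>)) (fst (out ! p (2 * n))) \<tau>"
      "snd (out ! p (2 * n)) = regs \<tau> 0"
      "serve B \<omega> c \<tau> (drop (p (Suc (2 * n))) wss) (drop (p (Suc (2 * n))) out)"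
      by (rule serve_drop[of B \<omega> c "guest \<sigma>" "p (2 * n)" wss out, unfolded p_Suc])
        (use * p_less[of "2 * n"] in auto)
    have regs_\<tau>: "\<forall>r. regs \<tau> r \<le> B'"
      by (rule exec_regs_le[OF \<tau>(1) B(2) bounds(2)]) (use * in \<open>simp add: put_request_regs\<close>)
    \<comment> \<open>The position after the query is the first one of the next round.\<close>
    have p_next: "p (Suc (2 * n)) = Suc t * (2 * n + 1)" by (simp add: p_def)
    let ?\<sigma>1 = "\<sigma>\<lparr>arrs := (arrs \<sigma>)(3 := (arrs \<sigma> 3)(0 := 0, 1 := 0, 2 := 0))\<rparr>"
    have "guest ?\<sigma>1 = put_request (wss ! p (2 * n)) (guest \<sigma>)"
      using wss_nth[of "2 * n"] guest_send[of \<sigma> 0 0 0] by simp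
    then have "wp B' \<omega> (shift_com c)
        (\<lambda>s \<sigma>'. s = fst (out ! p (2 * n)) \<and> guest \<sigma>' = \<tau> \<and> same_host ?\<sigma>1 \<sigma>') ?\<sigma>1"
      using \<tau>(1) by (intro wp_shift[OF _ B(2)]) auto
    then have run: "wp B' \<omega> (Seq (shift_com c) (Assign 0 (Bin Less (Lit 0) (Reg 8))))
        (\<lambda>s \<sigma>. s \<le> fst (out ! p (2 * n)) + 10 \<and> regs \<sigma> 0 = of_bool (snd (out ! p (2 * n)) > 0) \<and>
         round_inv B' B \<omega> c n uvs out (Suc t) \<sigma>) ?\<sigma>1"
      unfolding wp_Seq
    proof (rule wp_mono, elim conjE)
      fix s \<sigma>' assume \<sigma>': "s = fst (out ! p (2 * n))" "guest \<sigma>' = \<tau>" "same_host ?\<sigma>1 \<sigma>'"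
      have host: "regs \<sigma>' 1 = n" "arrs \<sigma>' 2 = arrs \<sigma> 2"
        using * \<sigma>'(3) by (simp_all add: same_host_def)
      have answer: "regs \<sigma>' 8 = regs \<tau> 0" using \<sigma>'(2) by (auto simp: guest_def)
      then have "regs \<sigma>' 8 \<le> B'" using regs_\<tau> by simp
      \<comment> \<open>Array 2 now holds the whole current pair, which is what
        \<open>prev_coord\<close> means in round \<open>Suc t\<close>. Writing the answer to
        register 0 touches neither the guest nor the invariant.\<close>
      moreover have "round_inv B' B \<omega> c n uvs out (Suc t) (\<sigma>'\<lparr>regs := (regs \<sigma>')(0 := v)\<rparr>)" for v
        using * \<sigma>'(2) host \<tau>(3) regs_\<tau> unfolding round_inv_def p_next wss_def
        by (simp add: guest_host_reg prev_coord_def)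
      ultimately show "wp B' \<omega> (Assign 0 (Bin Less (Lit 0) (Reg 8)))
          (\<lambda>t' \<sigma>. s + t' \<le> fst (out ! p (2 * n)) + 10 \<and> regs \<sigma> 0 = of_bool (snd (out ! p (2 * n)) > 0) \<and>
            round_inv B' B \<omega> c n uvs out (Suc t) \<sigma>) \<sigma>'"
        using answer \<tau>(2) \<sigma>'(1) bounds by (simp add: wp_simps)
    qed
    have send: "wp B' \<omega> (send (Lit 0) (Lit 0) (Lit 0)) (\<lambda>s \<sigma>'. s \<le> 20 \<and> \<sigma>' = ?\<sigma>1) \<sigma>"
      using bounds unfolding send_def by (simp add: wp_simps)
    show ?thesis
      unfolding wp_Seq[of _ _ "send _ _ _"]
      by (rule wp_mono[OF send], elim conjE, simp only:, rule wp_mono[OF run]) auto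
  qed
  \<comment> \<open>Overhead of \<open>100 + 4\<close> for each of \<open>2 * n\<close> coordinates.
    With 4 for the last loop test, 50 for the tail and 6 for the two initial assignments it stays
    below \<open>300 * (n + 1)\<close>.\<close>
  have time: "(\<Sum>k<2 * n. fst (out ! p k) + 100 + 4) = (\<Sum>k<2 * n. fst (out ! p k)) + 208 * n"
    by (simp add: sum.distrib)
  let ?S = "\<Sum>k<2 * n. fst (out ! p k)"
  have loop_tail: "wp B' \<omega> (Seq (Loop (Bin Less (Reg 3) (Reg 4)) (respond_body c))
      (Seq (send (Lit 0) (Lit 0) (Lit 0)) (Seq (shift_com c) (Assign 0 (Bin Less (Lit 0) (Reg 8))))))
      (\<lambda>s \<sigma>. s \<le> ?S + fst (out ! p (2 * n)) + (208 * n + 54) \<and>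
         regs \<sigma> 0 = of_bool (snd (out ! p (2 * n)) > 0) \<and> round_inv B' B \<omega> c n uvs out (Suc t) \<sigma>) ?\<sigma>'"
    unfolding wp_Seq[of _ _ "Loop _ _"]
  proof (rule wp_mono[OF loop], elim conjE)
    fix s \<sigma> assume "s \<le> (\<Sum>k<2 * n. fst (out ! p k) + 100 + 4) + 4" "I (2 * n) \<sigma>"
    then show "wp B' \<omega> (Seq (send (Lit 0) (Lit 0) (Lit 0)) (Seq (shift_com c) (Assign 0 (Bin Less (Lit 0) (Reg 8)))))
      (\<lambda>t' \<sigma>. s + t' \<le> ?S + fst (out ! p (2 * n)) + (208 * n + 54) \<and>
         regs \<sigma> 0 = of_bool (snd (out ! p (2 * n)) > 0) \<and> round_inv B' B \<omega> c n uvs out (Suc t) \<sigma>) \<sigma>"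
      unfolding time by (intro wp_mono[OF tail]) auto
  qed
  show ?thesis
    unfolding respond_com_def wp_Seq[of _ _ "Assign 3 _"] wp_Seq[of _ _ "Assign 4 _"] wp_Assign
      p_def[symmetric]
    using loop_tail inv' bounds 
    by (simp add: put_request_regs split del: split_of_bool) (erule wp_mono, simp)
qed

text \<open>Stated for a single tape and an arbitrary guest run, so that it serves both the time
  bound, required on every tape, and the inclusion of the success events.\<close>

lemma oumv_alg_run:
  assumes B: "40 * (n + 1) ^ 2 \<le> B'" "B \<le> B'" and "length uvs = n"
    and run: "online_run B \<omega> A (striangle_input (2 * n + 2) 0 (oumv_graph n M) (oumv_predictions n))
      (map encode_request (oumv_requests n uvs)) t\<^sub>0 out"
  shows "\<exists>t\<^sub>0' out'.
    online_run B' \<omega> (oumv_alg A) (oumv_input n M) (map (encode_pair n) uvs) t\<^sub>0' out' \<and>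
    t\<^sub>0' \<le> t\<^sub>0 + 2000 * (n + 1) ^ 2 \<and> length out' = n \<and>
    (\<forall>t<n. fst (out' ! t) \<le> (\<Sum>j<2 * n. fst (out ! (t * (2 * n + 1) + j))) +
              fst (out ! (t * (2 * n + 1) + 2 * n)) + 300 * (n + 1) \<and>
           snd (out' ! t) = of_bool (snd (out ! (t * (2 * n + 1) + 2 * n)) > 0))"
proof -
  from run obtain \<tau> where
    pre: "exec B \<omega> (preprocess A) (striangle_input (2 * n + 2) 0 (oumv_graph n M) (oumv_predictions n)) t\<^sub>0 \<tau>"
    and serve: "serve B \<omega> (respond A) \<tau> (map encode_request (oumv_requests n uvs)) out"
    unfolding online_run_def by blast
  from wp_preprocess_com[OF B pre] obtain t\<^sub>0' \<sigma> where
    1: "exec B' \<omega> (preprocess_com (preprocess A)) (oumv_input n M) t\<^sub>0' \<sigma>"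
    "t\<^sub>0' \<le> t\<^sub>0 + 2000 * (n + 1) ^ 2"
    and \<sigma>: "regs \<sigma> 1 = n" "arrs \<sigma> 2 = (\<lambda>_. 0)" "guest \<sigma> = \<tau>" "\<forall>r. regs \<tau> r \<le> B'"
    unfolding wp_def by blast
  let ?I = "round_inv B' B \<omega> (respond A) n uvs out"
  have "?I 0 \<sigma>" using \<sigma> serve by (simp add: round_inv_def prev_coord_def)
  have "\<exists>out'. serve B' \<omega> (respond_com (respond A)) \<sigma> (map (encode_pair n) uvs) out' \<and>
      length out' = length (map (encode_pair n) uvs) \<and>
      (\<forall>t<length (map (encode_pair n) uvs).
         fst (out' ! t) \<le> (\<Sum>j<2 * n. fst (out ! (t * (2 * n + 1) + j))) +
              fst (out ! (t * (2 * n + 1) + 2 * n)) + 300 * (n + 1) \<and>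
         snd (out' ! t) = of_bool (snd (out ! (t * (2 * n + 1) + 2 * n)) > 0))"
  proof (rule serve_rounds[where I = ?I])
    fix t \<sigma> assume "t < length (map (encode_pair n) uvs)" "?I t \<sigma>"
    then show "wp B' \<omega> (respond_com (respond A))
     (\<lambda>k \<sigma>. k \<le> (\<Sum>j<2 * n. fst (out ! (t * (2 * n + 1) + j))) + fst (out ! (t * (2 * n + 1) + 2 * n))
               + 300 * (n + 1) \<and>
            regs \<sigma> 0 = of_bool (snd (out ! (t * (2 * n + 1) + 2 * n)) > 0) \<and> ?I (Suc t) \<sigma>)
     (put_request (map (encode_pair n) uvs ! t) \<sigma>)"
      using wp_respond_com[OF B, of t] assms(3) by simp
  qed fact
  then show ?thesis
    using 1 unfolding online_run_def oumv_alg_def online_alg.simps length_map assms(3) by blast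
qed


section \<open>Resource bounds\<close>

lemma poly_bounded_add: "poly_bounded f \<Longrightarrow> poly_bounded g \<Longrightarrow> poly_bounded (\<lambda>n. f n + g n)"
proof -
  assume "poly_bounded f" "poly_bounded g"
  then obtain j k where jk: "f \<in> O(\<lambda>n. real n ^ j)" "g \<in> O(\<lambda>n. real n ^ k)"
    unfolding poly_bounded_def by blast
  have le: "(\<lambda>n. real n ^ i) \<in> O(\<lambda>n. real n ^ max j k)" if "i \<le> max j k" for i
    by (rule landau_o.bigI[of 1])
      (use that in \<open>auto intro!: eventually_mono[OF eventually_ge_at_top[of 1]] power_increasing\<close>)
  have "(\<lambda>n. f n + g n) \<in> O(\<lambda>n. real n ^ max j k)"
    by (intro sum_in_bigo landau_o.big_trans[OF jk(1) le] landau_o.big_trans[OF jk(2) le]) auto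
  then show ?thesis unfolding poly_bounded_def by blast
qed

lemma poly_bounded_square: "poly_bounded (\<lambda>n. c * (real n + 1) ^ 2)"
  unfolding poly_bounded_def
proof (intro exI)
  show "(\<lambda>n. c * (real n + 1) ^ 2) \<in> O(\<lambda>n. real n ^ 2)"
  proof (rule landau_o.bigI[of "4 * \<bar>c\<bar> + 1"])
    show "eventually (\<lambda>n. norm (c * (real n + 1) ^ 2) \<le> (4 * \<bar>c\<bar> + 1) * norm (real n ^ 2)) at_top"
      using eventually_ge_at_top[of 1]
    proof eventually_elim
      case (elim n)
      then have "(real n + 1) ^ 2 \<le> (2 * real n) ^ 2" by (intro power_mono) auto
      then have "\<bar>c\<bar> * (real n + 1) ^ 2 \<le> \<bar>c\<bar> * (4 * real n ^ 2)"
        by (intro mult_left_mono) (auto simp: power_mult_distrib)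
      also have "\<dots> \<le> (4 * \<bar>c\<bar> + 1) * real n ^ 2" by (simp add: algebra_simps)
      finally show ?case by (simp add: abs_mult)
    qed
  qed simp
qed

text \<open>The argument is the size \<open>n + T\<close> of the constructed instance:
  \<open>2 * n + 2\<close> vertices and \<open>n * (2 * n + 1)\<close> predicted sets. It is at most
  \<open>7 * n ^ 2\<close> for \<open>n \<ge> 1\<close>, with 7 = 2 + 3 + 2, hence the exponent
  doubles.\<close>

lemma poly_bounded_input_size:
  assumes "poly_bounded f"
  shows "poly_bounded (\<lambda>n. f (2 * n + 2 + n * (2 * n + 1)))"
proof -
  let ?h = "\<lambda>n::nat. 2 * n + 2 + n * (2 * n + 1)"
  from assms obtain k where k: "f \<in> O(\<lambda>n. real n ^ k)" unfolding poly_bounded_def by blast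
  have "filterlim ?h at_top at_top"
    by (rule filterlim_at_top_mono[OF filterlim_ident]) (auto intro: always_eventually)
  from landau_o.big.compose[OF k this] have "(\<lambda>n. f (?h n)) \<in> O(\<lambda>n. real (?h n) ^ k)" .
  also have "(\<lambda>n. real (?h n) ^ k) \<in> O(\<lambda>n. real n ^ (2 * k))"
  proof (rule landau_o.bigI[of "7 ^ k"])
    show "eventually (\<lambda>n. norm (real (?h n) ^ k) \<le> 7 ^ k * norm (real n ^ (2 * k))) at_top"
      using eventually_ge_at_top[of 1]
    proof eventually_elim
      case (elim n)
      then have "n \<le> n * n" "1 \<le> n * n" by auto
      moreover have "?h n = 2 * (n * n) + 3 * n + 2" by (simp add: algebra_simps)
      ultimately have "?h n \<le> 7 * (n * n)" by linarith
      then have "real (?h n) \<le> 7 * real n ^ 2"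
        unfolding power2_eq_square by (metis of_nat_le_iff of_nat_mult of_nat_numeral)
      then have "real (?h n) ^ k \<le> (7 * real n ^ 2) ^ k" by (intro power_mono) auto
      then show ?case by (simp add: power_mult_distrib power_mult)
    qed
  qed simp
  finally show ?thesis unfolding poly_bounded_def by blast
qed

text \<open>The smallness assumption is applied at \<open>2 * n + 2\<close>, and
  \<open>2 * n + 2 \<le> 4 * n\<close> for \<open>n \<ge> 1\<close> brings in the factor
  \<open>4 powr (3 - \<epsilon>')\<close>. Nonnegativity allows the coefficients to be enlarged and
  the absolute value in the O-bound to be dropped.\<close>

lemma total_time_bound:
  fixes U Q :: "nat \<Rightarrow> real"
  assumes "poly_smaller (\<lambda>n. real n ^ 2 * U n + real n * Q n) 3"
    and nonneg: "\<And>n. 0 \<le> U (2 * n + 2)" "\<And>n. 0 \<le> Q (2 * n + 2)"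
  shows "\<exists>\<epsilon>>0. (\<lambda>n. real n * (2 * real n * U (2 * n + 2) + Q (2 * n + 2) + c * (real n + 1)))
    \<in> O(\<lambda>n. real n powr (3 - \<epsilon>))"
proof -
  from assms(1) obtain C \<epsilon> where C: "C > 0" "\<epsilon> > 0"
    and ev: "eventually (\<lambda>n. real n ^ 2 * U n + real n * Q n \<le> C * real n powr (3 - \<epsilon>)) at_top"
    unfolding poly_smaller_def by blast
  \<comment> \<open>The host alone needs quadratic time, so no saving beyond 1 in the exponent can
    be claimed. The cap also makes the exponent \<open>3 - \<epsilon>'\<close> at least 2, as the
    monotonicity of powers requires.\<close>
  define \<epsilon>' where "\<epsilon>' = min \<epsilon> 1"
  have \<epsilon>': "\<epsilon>' > 0" "\<epsilon>' \<le> 1" "\<epsilon>' \<le> \<epsilon>" using C by (auto simp: \<epsilon>'_def)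
  have "filterlim (\<lambda>n::nat. 2 * n + 2) at_top at_top"
    by (rule filterlim_at_top_mono[OF filterlim_ident]) (auto intro: always_eventually)
  from eventually_compose_filterlim[OF ev this]
  have ev': "eventually (\<lambda>n. real (2 * n + 2) ^ 2 * U (2 * n + 2) + real (2 * n + 2) * Q (2 * n + 2)
      \<le> C * real (2 * n + 2) powr (3 - \<epsilon>)) at_top" .
  let ?K = "C * 4 powr (3 - \<epsilon>') + 2 * \<bar>c\<bar>"
  have "(\<lambda>n. real n * (2 * real n * U (2 * n + 2) + Q (2 * n + 2) + c * (real n + 1)))
    \<in> O(\<lambda>n. real n powr (3 - \<epsilon>'))"
  proof (rule landau_o.bigI[of ?K])
    have "0 < C * 4 powr (3 - \<epsilon>')" using C by simp
    then show "0 < ?K" by linarith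
    show "eventually (\<lambda>n. norm (real n * (2 * real n * U (2 * n + 2) + Q (2 * n + 2) + c * (real n + 1)))
      \<le> ?K * norm (real n powr (3 - \<epsilon>'))) at_top"
      using ev' eventually_ge_at_top[of 1]
    proof eventually_elim
      case (elim n)
      define N where "N = real (2 * n + 2)"
      define u q where "u = U (2 * n + 2)" and "q = Q (2 * n + 2)"
      have uq: "0 \<le> u" "0 \<le> q" using nonneg by (auto simp: u_def q_def)
      have n1: "1 \<le> real n" using elim by simp
      have N: "real n \<le> N" "2 * real n \<le> N" "1 \<le> N" "N \<le> 4 * real n" using elim by (auto simp: N_def)
      have "2 * real n * real n \<le> N * N" using N n1 by (intro mult_mono) auto
      then have "2 * real n * real n * u \<le> N ^ 2 * u"
        using uq unfolding power2_eq_square by (intro mult_right_mono) auto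
      moreover have "real n * q \<le> N * q" using N uq by (intro mult_right_mono) auto
      ultimately have "2 * real n * real n * u + real n * q \<le> C * N powr (3 - \<epsilon>)"
        using elim(1) unfolding N_def[symmetric] u_def[symmetric] q_def[symmetric] by linarith
      also have "N powr (3 - \<epsilon>) \<le> N powr (3 - \<epsilon>')" using N \<epsilon>' by (intro powr_mono) auto
      also have "N powr (3 - \<epsilon>') \<le> (4 * real n) powr (3 - \<epsilon>')"
        using N \<epsilon>' by (intro powr_mono2) auto
      also have "\<dots> = 4 powr (3 - \<epsilon>') * real n powr (3 - \<epsilon>')" by (simp add: powr_mult)
      finally have 1: "2 * real n * real n * u + real n * q \<le> C * (4 powr (3 - \<epsilon>') * real n powr (3 - \<epsilon>'))"
        using C by simp
      have "real n * (real n + 1) \<le> real n * (2 * real n)" using n1 by (intro mult_left_mono) auto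
      also have "\<dots> = 2 * real n powr 2" using n1 by (simp add: power2_eq_square)
      also have "\<dots> \<le> 2 * real n powr (3 - \<epsilon>')"
        using n1 \<epsilon>' by (intro mult_left_mono powr_mono) auto
      finally have 2: "\<bar>c\<bar> * (real n * (real n + 1)) \<le> \<bar>c\<bar> * (2 * real n powr (3 - \<epsilon>'))"
        by (intro mult_left_mono) auto
      have "\<bar>real n * (2 * real n * u + q + c * (real n + 1))\<bar> \<le>
          \<bar>2 * real n * real n * u + real n * q\<bar> + \<bar>c * (real n * (real n + 1))\<bar>"
        by (rule order_trans[OF _ abs_triangle_ineq]) (simp add: algebra_simps)
      also have "\<dots> = 2 * real n * real n * u + real n * q + \<bar>c\<bar> * (real n * (real n + 1))"
        using uq by (simp add: abs_mult)
      also have "\<dots> \<le> ?K * real n powr (3 - \<epsilon>')" using 1 2 by (simp add: algebra_simps)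
      finally show ?case unfolding u_def q_def by simp
    qed
  qed
  then show ?thesis using \<epsilon>'(1) by blast
qed

section \<open>From predicted triangle counting to OuMv\<close>

lemma solves_striangle_predictedE:
  assumes "solves_striangle_predicted L \<delta> A P U Q"
  obtains W where "poly_bounded (\<lambda>m. real (W m))"
    and "\<And>n s G ps \<rho> \<omega>. s < n \<Longrightarrow> G \<subseteq> all_edges n \<Longrightarrow> (\<forall>p\<in>set ps. distinct p \<and> set p \<subseteq> requests n) \<Longrightarrow>
      list_accurate L (map set ps) {\<rho>} \<Longrightarrow> \<exists>t0 out.
        online_run (W (n + length ps)) \<omega> A (striangle_input n s G ps) (map encode_request \<rho>) t0 out \<and>
        real t0 \<le> P (n + length ps) \<and>
        (\<forall>t<length \<rho>. real (fst (out ! t)) \<le> (if \<rho> ! t = Query then Q n else U n))"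
    and "\<And>n s G ps \<rho>. s < n \<Longrightarrow> G \<subseteq> all_edges n \<Longrightarrow> (\<forall>p\<in>set ps. distinct p \<and> set p \<subseteq> requests n) \<Longrightarrow>
      list_accurate L (map set ps) {\<rho>} \<Longrightarrow> measure coin_space {\<omega>. \<exists>t0 out.
        online_run (W (n + length ps)) \<omega> A (striangle_input n s G ps) (map encode_request \<rho>) t0 out \<and>
        striangle_correct s G \<rho> out} \<ge> 1 - \<delta>"
proof -
  from assms obtain W where W: "poly_bounded (\<lambda>m. real (W m))"
    and *: "\<forall>n s G ps \<rho>. s < n \<and> G \<subseteq> all_edges n \<and>
      (\<forall>p\<in>set ps. distinct p \<and> set p \<subseteq> requests n) \<and> list_accurate L (map set ps) {\<rho>} \<longrightarrow>
      (\<forall>\<omega>. \<exists>t0 out.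
        online_run (W (n + length ps)) \<omega> A (striangle_input n s G ps) (map encode_request \<rho>) t0 out \<and>
        real t0 \<le> P (n + length ps) \<and>
        (\<forall>t<length \<rho>. real (fst (out ! t)) \<le> (if \<rho> ! t = Query then Q n else U n))) \<and>
      measure coin_space {\<omega>. \<exists>t0 out.
        online_run (W (n + length ps)) \<omega> A (striangle_input n s G ps) (map encode_request \<rho>) t0 out \<and>
        striangle_correct s G \<rho> out} \<ge> 1 - \<delta>"
    unfolding solves_striangle_predicted_def by blast
  show ?thesis
  proof (rule that[OF W], goal_cases)
    case (1 n s G ps \<rho> \<omega>)
    then show ?case using *[rule_format, of s n G ps \<rho>] by blast
  next
    case (2 n s G ps \<rho>)
    then show ?case using *[rule_format, of s n G ps \<rho>] by blast
  qed
qed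

text \<open>The bounds dominate an actual running time: a single request, predicted by itself on the
  empty graph, already yields a nonnegative lower bound. Two vertices are needed for an edge to
  exist.\<close>

lemma striangle_time_nonneg:
  assumes "solves_striangle_predicted 2 \<delta> A P U Q"
  shows "0 \<le> U (n + 2)" "0 \<le> Q (n + 2)"
proof -
  have nonneg: "0 \<le> (if r = Query then Q (n + 2) else U (n + 2))" if r: "r \<in> requests (n + 2)" for r
  proof (rule solves_striangle_predictedE[OF assms], goal_cases)
    case (1 W)
    have "list_accurate 2 (map set [[r]]) {[r]}" by (simp add: list_accurate_def)
    from 1(2)[of 0 "n + 2" "{}" "[[r]]" "[r]", OF _ _ _ this] r
    obtain out :: "(nat \<times> nat) list" where
      "real (fst (out ! 0)) \<le> (if r = Query then Q (n + 2) else U (n + 2))"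
      by auto
    then show ?case by (meson of_nat_0_le_iff order_trans)
  qed
  have "Flip {0, 1} \<in> requests (n + 2)" unfolding requests_def by (auto intro!: doubleton_in_all_edges)
  from nonneg[OF this] show "0 \<le> U (n + 2)" by simp
  show "0 \<le> Q (n + 2)" using nonneg[of Query] by (simp add: requests_def)
qed

lemma striangle_correct_imp_uMv:
  assumes "striangle_correct 0 (oumv_graph n M) (oumv_requests n uvs) out" and "t < n"
  shows "snd (out ! (t * (2 * n + 1) + 2 * n)) > 0 \<longleftrightarrow>
    bool_uMv n M (fst (uvs ! t)) (snd (uvs ! t))"
proof -
  have "oumv_requests n uvs ! (t * (2 * n + 1) + 2 * n) = Query"
    using oumv_requests_nth[OF assms(2) order_refl] by simp
  then have "snd (out ! (t * (2 * n + 1) + 2 * n)) = card (triangles_at 0 (graph_at n M uvs t (2 * n)))"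
    using assms(1) position_less[OF assms(2) order_refl]
    unfolding striangle_correct_def graph_at_def length_oumv_requests by blast
  then show ?thesis using card_triangles_iff_uMv[OF assms(2)] by simp
qed

lemma oumv_alg_solves_oumv:
  assumes "solves_striangle_predicted 2 \<delta> A P U Q"
  shows "solves_oumv \<delta> (oumv_alg A)
    (\<lambda>n. P (2 * n + 2 + n * (2 * n + 1)) + 2000 * (real n + 1) ^ 2)
    (\<lambda>n. real n * (2 * real n * U (2 * n + 2) + Q (2 * n + 2) + 300 * (real n + 1)))"
proof (rule solves_striangle_predictedE[OF assms], goal_cases)
  case (1 W)
  define W' where "W' n = W (2 * n + 2 + n * (2 * n + 1)) + 40 * (n + 1) ^ 2" for n
  have "poly_bounded (\<lambda>n. real (W' n))"
    using poly_bounded_add[OF poly_bounded_input_size[OF 1(1)] poly_bounded_square[of 40]]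
    by (simp add: W'_def add.commute)
  moreover have
    "(\<forall>\<omega>. \<exists>t0 out. online_run (W' n) \<omega> (oumv_alg A) (oumv_input n M) (map (encode_pair n) uvs) t0 out \<and>
        real t0 \<le> P (2 * n + 2 + n * (2 * n + 1)) + 2000 * (real n + 1) ^ 2 \<and>
        real (sum_list (map fst out)) \<le>
          real n * (2 * real n * U (2 * n + 2) + Q (2 * n + 2) + 300 * (real n + 1))) \<and>
     measure coin_space {\<omega>. \<exists>t0 out.
        online_run (W' n) \<omega> (oumv_alg A) (oumv_input n M) (map (encode_pair n) uvs) t0 out \<and>
        oumv_correct n M uvs out} \<ge> 1 - \<delta>"
    if len: "length uvs = n" for n M uvs
  proof -
    let ?N = "2 * n + 2" and ?T = "n * (2 * n + 1)"
    let ?ps = "oumv_predictions n" and ?\<rho> = "oumv_requests n uvs" and ?G = "oumv_graph n M"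
    let ?p = "\<lambda>t k. t * (2 * n + 1) + k"
    have valid: "0 < ?N" "?G \<subseteq> all_edges ?N" "\<forall>p\<in>set ?ps. distinct p \<and> set p \<subseteq> requests ?N"
      "list_accurate 2 (map set ?ps) {?\<rho>}"
      using oumv_graph_subset oumv_predictions_valid oumv_requests_accurate by auto
    note A_run = 1(2)[OF valid, unfolded length_oumv_predictions]
      and A_correct = 1(3)[OF valid, unfolded length_oumv_predictions]
    have W': "40 * (n + 1) ^ 2 \<le> W' n" "W (?N + ?T) \<le> W' n" by (simp_all add: W'_def)
    note sim = oumv_alg_run[OF W' len]
    have "\<exists>t0 out. online_run (W' n) \<omega> (oumv_alg A) (oumv_input n M) (map (encode_pair n) uvs) t0 out \<and>
        real t0 \<le> P (?N + ?T) + 2000 * (real n + 1) ^ 2 \<and>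
        real (sum_list (map fst out)) \<le> real n * (2 * real n * U ?N + Q ?N + 300 * (real n + 1))" for \<omega>
    proof -
      obtain t0 out where run: "online_run (W (?N + ?T)) \<omega> A (striangle_input ?N 0 ?G ?ps) (map encode_request ?\<rho>) t0 out"
        and t0: "real t0 \<le> P (?N + ?T)"
        and time: "\<forall>t<length ?\<rho>. real (fst (out ! t)) \<le> (if ?\<rho> ! t = Query then Q ?N else U ?N)"
        using A_run[of \<omega>] by blast
      from sim[OF run] obtain t0' out' where run': "online_run (W' n) \<omega> (oumv_alg A) (oumv_input n M) (map (encode_pair n) uvs) t0' out'"
        and t0': "t0' \<le> t0 + 2000 * (n + 1) ^ 2" and len': "length out' = n"
        and time': "\<forall>t<n. fst (out' ! t) \<le> (\<Sum>j<2 * n. fst (out ! ?p t j)) + fst (out ! ?p t (2 * n)) + 300 * (n + 1)"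
        by blast
      have "real t0' \<le> real (t0 + 2000 * (n + 1) ^ 2)" using t0' by (simp only: of_nat_le_iff)
      then have "real t0' \<le> P (?N + ?T) + 2000 * (real n + 1) ^ 2" using t0 by (simp add: add.commute)
      moreover have "real (sum_list (map fst out')) \<le> real n * (2 * real n * U ?N + Q ?N + 300 * (real n + 1))"
      proof -
        have round: "real (fst (out' ! t)) \<le> 2 * real n * U ?N + Q ?N + 300 * (real n + 1)" if "t < n" for t
        proof -
          \<comment> \<open>By the layout of positions, offsets below \<open>2 * n\<close> are
            updates and offset \<open>2 * n\<close> is the query, so each round is charged
            \<open>2 * n\<close> times \<open>U\<close> and once \<open>Q\<close>.\<close>
          have u: "real (fst (out ! ?p t j)) \<le> U ?N" if "j < 2 * n" for j
            using time[rule_format, of "?p t j"] position_less[of t n j] oumv_requests_nth[of t n j uvs]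
              \<open>t < n\<close> that unfolding length_oumv_requests by simp
          have "real (fst (out ! ?p t (2 * n))) \<le> Q ?N"
            using time[rule_format, of "?p t (2 * n)"] position_less[of t n "2 * n"]
              oumv_requests_nth[of t n "2 * n" uvs] \<open>t < n\<close> unfolding length_oumv_requests by simp
          moreover have "(\<Sum>j<2 * n. real (fst (out ! ?p t j))) \<le> real (card {..<2 * n}) * U ?N"
            by (rule sum_bounded_above) (use u in auto)
          moreover have "real (fst (out' ! t)) \<le>
              real ((\<Sum>j<2 * n. fst (out ! ?p t j)) + fst (out ! ?p t (2 * n)) + 300 * (n + 1))"
            using time' that by (simp only: of_nat_le_iff)
          ultimately show ?thesis by (simp add: algebra_simps)
        qed
        have "real (sum_list (map fst out')) = (\<Sum>t<n. real (fst (out' ! t)))"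
          using len' by (simp add: sum_list_sum_nth atLeast0LessThan)
        also have "\<dots> \<le> real (card {..<n}) * (2 * real n * U ?N + Q ?N + 300 * (real n + 1))"
          by (rule sum_bounded_above) (use round in auto)
        finally show ?thesis by simp
      qed
      ultimately show ?thesis using run' by blast
    qed
    moreover have "measure coin_space {\<omega>. \<exists>t0 out.
        online_run (W' n) \<omega> (oumv_alg A) (oumv_input n M) (map (encode_pair n) uvs) t0 out \<and>
        oumv_correct n M uvs out} \<ge> 1 - \<delta>"
    proof -
      interpret prob_space coin_space by (rule prob_space_coin_space)
      have "{\<omega>. \<exists>t0 out. online_run (W (?N + ?T)) \<omega> A (striangle_input ?N 0 ?G ?ps) (map encode_request ?\<rho>) t0 out \<and>
            striangle_correct 0 ?G ?\<rho> out}
         \<subseteq> {\<omega>. \<exists>t0 out. online_run (W' n) \<omega> (oumv_alg A) (oumv_input n M) (map (encode_pair n) uvs) t0 out \<and>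
            oumv_correct n M uvs out}"
      proof (rule subsetI, elim CollectE exE conjE)
        fix \<omega> t0 out
        assume run: "online_run (W (?N + ?T)) \<omega> A (striangle_input ?N 0 ?G ?ps) (map encode_request ?\<rho>) t0 out"
          and correct: "striangle_correct 0 ?G ?\<rho> out"
        from sim[OF run] obtain t0' out' where run': "online_run (W' n) \<omega> (oumv_alg A) (oumv_input n M) (map (encode_pair n) uvs) t0' out'"
          and ans: "\<forall>t<n. snd (out' ! t) = of_bool (snd (out ! ?p t (2 * n)) > 0)"
          by blast
        have "oumv_correct n M uvs out'"
          unfolding oumv_correct_def len
          using ans striangle_correct_imp_uMv[OF correct] by simp
        with run' show "\<omega> \<in> {\<omega>. \<exists>t0 out. online_run (W' n) \<omega> (oumv_alg A) (oumv_input n M) (map (encode_pair n) uvs) t0 out \<and>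
            oumv_correct n M uvs out}" by blast
      qed
      \<comment> \<open>The larger event has to be measurable: \<open>measure\<close> is 0 on
        non-measurable sets, so inclusion alone would not transfer the lower bound.\<close>
      from finite_measure_mono[OF this sets_online_run] A_correct show ?thesis by linarith
    qed
    ultimately show ?thesis by blast
  qed
  ultimately show ?case unfolding solves_oumv_def by blast
qed

lemma solves_oumv_mono: "solves_oumv \<delta> alg P \<tau> \<Longrightarrow> \<delta> \<le> \<delta>' \<Longrightarrow> solves_oumv \<delta>' alg P \<tau>"
  unfolding solves_oumv_def by (meson diff_left_mono order_trans)

text \<open>Randomised algorithms are covered too: the reduction preserves \<open>\<delta>\<close>,
  and the conjecture excludes every error up to \<open>1 / 3\<close>.\<close>

theorem theorem5p3:
  fixes A :: online_alg and P U Q :: "nat \<Rightarrow> real" and \<delta> :: real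
  assumes "0 \<le> \<delta>" and "\<delta> \<le> 1 / 3"
    and "poly_bounded P"
    and "solves_striangle_predicted (2 ^ 1) \<delta> A P U Q"
    and "OuMv_conjecture"
  shows "\<not> poly_smaller (\<lambda>n. real n ^ 2 * U n + real n * Q n) 3"
proof
  assume small: "poly_smaller (\<lambda>n. real n ^ 2 * U n + real n * Q n) 3"
  have A: "solves_striangle_predicted 2 \<delta> A P U Q" using assms(4) by simp
  obtain \<epsilon> where "\<epsilon> > 0" and time: "(\<lambda>n. real n * (2 * real n * U (2 * n + 2) + Q (2 * n + 2) +
      300 * (real n + 1))) \<in> O(\<lambda>n. real n powr (3 - \<epsilon>))"
    using total_time_bound[OF small striangle_time_nonneg[OF A]] by blast
  have "poly_bounded (\<lambda>n. P (2 * n + 2 + n * (2 * n + 1)) + 2000 * (real n + 1) ^ 2)"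
    by (intro poly_bounded_add poly_bounded_input_size poly_bounded_square assms(3))
  moreover have "solves_oumv (1 / 3) (oumv_alg A)
      (\<lambda>n. P (2 * n + 2 + n * (2 * n + 1)) + 2000 * (real n + 1) ^ 2)
      (\<lambda>n. real n * (2 * real n * U (2 * n + 2) + Q (2 * n + 2) + 300 * (real n + 1)))"
    by (rule solves_oumv_mono[OF oumv_alg_solves_oumv[OF A] assms(2)])
  ultimately show False
    using assms(5) \<open>\<epsilon> > 0\<close> time unfolding OuMv_conjecture_def by blast
qed

end
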